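(* Let $k$ be a positive integer, and let $G$ be a minimally $k$-connected graph. Then: (a) $G$ is $\mathcal{R}_k$-independent; (b) for every subgraph $G'=(V',E')$ of $G$ with $|V'|\ge k+1$ we have \[|E'|\le r_{k-1}(G')+|V'|-k\le k|V'|-\binom{k+1}{2},\] where the first inequality holds with equality if and only if $G'$ is a complete graph $K_{k+1}$.
   Context: All graphs are finite and simple. A graph is minimally $k$-connected if it is $k$-connected but $G-e$ is not $k$-connected for every edge $e$. For a nonnegative integer $m$, $\mathcal{R}_m(G)$ is the row matroid of the rigidity matrix $R(G,p)$ of a generic framework $p:V\to\mathbb{R}^m$ (coordinates algebraically independent over $\mathbb{Q}$; the row of edge $xy$ has $p(x)-p(y)$ in the $m$ columns of $x$, $p(y)-p(x)$ in those of $y$, zeros elsewhere), and $r_m(G)$ is its rank (so $r_0\equiv 0$). $G$ is $\mathcal{R}_k$-independent if $E(G)$ is independent in $\mathcal{R}_k(G)$.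
   Formalization: That equality in the first inequality forces G' to be K_{k+1} is claimed only for k ≥ 2; for k = 1 it is false (for G = G' the path on 3 vertices, |E'| = 2 = r_0(G') + 3 - 1, but G' is not K_2). All other claims are for every k ≥ 1. *)

theory Defs
  imports Complex_Main "HOL-Library.Poly_Mapping"
begin

section \<open>Finite simple graphs\<close>

definition all_pairs :: "'a set \<Rightarrow> 'a set set" where
  "all_pairs V = {e. e \<subseteq> V \<and> card e = 2}"

definition simple_graph :: "'a set \<Rightarrow> 'a set set \<Rightarrow> bool" where
  "simple_graph V E \<longleftrightarrow> finite V \<and> E \<subseteq> all_pairs V"

definition subgraph :: "'a set \<Rightarrow> 'a set set \<Rightarrow> 'a set \<Rightarrow> 'a set set \<Rightarrow> bool" where
  "subgraph V' E' V E \<longleftrightarrow> simple_graph V' E' \<and> V' \<subseteq> V \<and> E' \<subseteq> E"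

definition is_complete_graph :: "nat \<Rightarrow> 'a set \<Rightarrow> 'a set set \<Rightarrow> bool" where
  "is_complete_graph n V E \<longleftrightarrow> finite V \<and> card V = n \<and> E = all_pairs V"

definition connected_graph :: "'a set \<Rightarrow> 'a set set \<Rightarrow> bool" where
  "connected_graph V E \<longleftrightarrow> V \<noteq> {} \<and> (\<forall>u\<in>V. \<forall>v\<in>V. (u, v) \<in> {(x, y). {x, y} \<in> E}\<^sup>*)"

text \<open>The requirement of at least \<open>k + 1\<close> vertices is the usual convention under which
  the complete graph on \<open>k + 1\<close> vertices is \<open>k\<close>-connected and no smaller graph is.\<close>

definition k_connected :: "nat \<Rightarrow> 'a set \<Rightarrow> 'a set set \<Rightarrow> bool" where
  "k_connected k V E \<longleftrightarrow> card V \<ge> k + 1 \<and>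
     (\<forall>S. S \<subseteq> V \<and> card S < k \<longrightarrow> connected_graph (V - S) {e \<in> E. e \<inter> S = {}})"

definition minimally_k_connected :: "nat \<Rightarrow> 'a set \<Rightarrow> 'a set set \<Rightarrow> bool" where
  "minimally_k_connected k V E \<longleftrightarrow>
     k_connected k V E \<and> (\<forall>e\<in>E. \<not> k_connected k V (E - {e}))"

section \<open>Generic frameworks\<close>

text \<open>A polynomial over the rationals in variables of type \<open>'i\<close> is a finitely supported map
  from monomials (finitely supported exponent maps) to coefficients.\<close>

definition eval_mpoly :: "('i \<Rightarrow> real) \<Rightarrow> (('i \<Rightarrow>\<^sub>0 nat) \<Rightarrow>\<^sub>0 rat) \<Rightarrow> real" where
  "eval_mpoly x f =
     (\<Sum>m\<in>Poly_Mapping.keys f. of_rat (Poly_Mapping.lookup f m) *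
        (\<Prod>i\<in>Poly_Mapping.keys m. x i ^ Poly_Mapping.lookup m i))"

definition mpoly_vars :: "(('i \<Rightarrow>\<^sub>0 nat) \<Rightarrow>\<^sub>0 rat) \<Rightarrow> 'i set" where
  "mpoly_vars f = (\<Union>m\<in>Poly_Mapping.keys f. Poly_Mapping.keys m)"

definition algebraically_independent :: "'i set \<Rightarrow> ('i \<Rightarrow> real) \<Rightarrow> bool" where
  "algebraically_independent I x \<longleftrightarrow>
     (\<forall>f. f \<noteq> 0 \<and> mpoly_vars f \<subseteq> I \<longrightarrow> eval_mpoly x f \<noteq> 0)"

text \<open>A framework in \<open>m\<close>-dimensional space is a function \<open>p\<close> whose coordinates \<open>p v i\<close> are
  relevant only for vertices \<open>v\<close> and \<open>i < m\<close>.\<close>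

definition generic_framework :: "nat \<Rightarrow> 'a set \<Rightarrow> ('a \<Rightarrow> nat \<Rightarrow> real) \<Rightarrow> bool" where
  "generic_framework m V p \<longleftrightarrow>
     algebraically_independent (V \<times> {..<m}) (\<lambda>(v, i). p v i)"

section \<open>The generic rigidity matroid\<close>

text \<open>Entry of the rigidity matrix in row \<open>e\<close> and in the \<open>i\<close>-th column of the vertex \<open>x\<close>;
  for \<open>e = {x, y}\<close> the element of \<open>e - {x}\<close> is \<open>y\<close>.\<close>

definition rigidity_matrix :: "('a \<Rightarrow> nat \<Rightarrow> real) \<Rightarrow> 'a set \<Rightarrow> 'a \<times> nat \<Rightarrow> real" where
  "rigidity_matrix p e = (\<lambda>(x, i). if x \<in> e then p x i - p (the_elem (e - {x})) i else 0)"

text \<open>Linear independence of the family of rows indexed by \<open>F\<close> (not merely of the set of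
  these rows).\<close>

definition rows_independent ::
    "nat \<Rightarrow> 'a set \<Rightarrow> ('a \<Rightarrow> nat \<Rightarrow> real) \<Rightarrow> 'a set set \<Rightarrow> bool" where
  "rows_independent m V p F \<longleftrightarrow>
     (\<forall>c. (\<forall>j\<in>V \<times> {..<m}. (\<Sum>e\<in>F. c e * rigidity_matrix p e j) = 0) \<longrightarrow> (\<forall>e\<in>F. c e = 0))"

text \<open>Generic frameworks exist for finite \<open>V\<close>, and all of them yield the same row matroid, so
  any one of them may be chosen.\<close>

definition some_generic_framework :: "nat \<Rightarrow> 'a set \<Rightarrow> 'a \<Rightarrow> nat \<Rightarrow> real" where
  "some_generic_framework m V = (SOME p. generic_framework m V p)"

definition rigidity_indep_sets :: "nat \<Rightarrow> 'a set \<Rightarrow> 'a set set \<Rightarrow> 'a set set set" where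
  "rigidity_indep_sets m V E =
     {F. F \<subseteq> E \<and> rows_independent m V (some_generic_framework m V) F}"

definition rigidity_rank :: "nat \<Rightarrow> 'a set \<Rightarrow> 'a set set \<Rightarrow> nat" where
  "rigidity_rank m V E = Max (card ` rigidity_indep_sets m V E)"

definition rigidity_independent :: "nat \<Rightarrow> 'a set \<Rightarrow> 'a set set \<Rightarrow> bool" where
  "rigidity_independent m V E \<longleftrightarrow> E \<in> rigidity_indep_sets m V E"

end

theory Submission
  imports Defs "Jordan_Normal_Form.Determinant" "HOL-Analysis.Continuum_Not_Denumerable"
begin

text \<open>Two separations belonging to consecutive edges \<open>xy\<close>, \<open>yz\<close> can be uncrossed as soon as \<open>y\<close> has
  degree greater than \<open>k\<close>. This is the argument behind Mader's theorem on the vertices of large degree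
  in a minimally \<open>k\<close>-connected graph, and it shows that every nonempty subgraph has a vertex of degree
  at most \<open>k\<close>. Since attaching a vertex by at most \<open>m\<close> edges preserves independence of the rows
  of a generic framework in \<open>m\<close>-dimensional space, \<open>k\<close>-degeneracy gives part (a).

  For (b), delete a vertex of degree \<open>d \<le> k\<close>. The rank in dimension \<open>k - 1\<close> drops by at least
  \<open>min d (k - 1)\<close>, so the quantity \<open>r + |V'| - k - |E'|\<close> does not grow, and it drops unless \<open>d = k\<close>.
  Hence equality is inherited down to \<open>k + 1\<close> vertices, where it forces a complete graph. Adding back a
  vertex of degree \<open>k \<ge> 2\<close> would produce an edge whose ends have \<open>k\<close> common neighbours, and such
  an edge cannot be critical. The second inequality is the dimension count for rigid motions.\<close>

section \<open>Degeneracy of minimally \<open>k\<close>-connected graphs\<close>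

definition neighbours :: "'a set set \<Rightarrow> 'a \<Rightarrow> 'a set" where
  "neighbours E v = {w. {v, w} \<in> E}"

text \<open>The separation is oriented, with \<open>x\<close> in \<open>A\<close> and
  \<open>y\<close> in \<open>B\<close>, so that separations of consecutive edges can be compared by
  the side lying ahead. By the last clause, only the edge \<open>xy\<close> can join
  \<open>A\<close> to \<open>B\<close>.\<close>

definition edge_separation ::
    "nat \<Rightarrow> 'a set \<Rightarrow> 'a set set \<Rightarrow> 'a \<Rightarrow> 'a \<Rightarrow> 'a set \<Rightarrow> 'a set \<Rightarrow> 'a set \<Rightarrow> bool" where
  "edge_separation k V E x y A S B \<longleftrightarrow>
     V = A \<union> S \<union> B \<and> A \<inter> S = {} \<and> A \<inter> B = {} \<and> S \<inter> B = {} \<and> x \<in> A \<and> y \<in> B \<and> card S < k \<and>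
     (\<forall>a\<in>A. \<forall>b\<in>B. {a, b} \<in> E \<longrightarrow> a = x \<and> b = y)"

lemma simple_graph_edgeD:
  assumes "simple_graph V E" "{x, y} \<in> E"
  shows "x \<in> V" "y \<in> V" "x \<noteq> y"
proof -
  have "{x, y} \<subseteq> V" "card {x, y} = 2"
    using assms by (auto simp: simple_graph_def all_pairs_def)
  then show "x \<in> V" "y \<in> V" "x \<noteq> y" by auto
qed

lemma neighbours_subset: "simple_graph V E \<Longrightarrow> neighbours E v \<subseteq> V - {v}"
  by (auto simp: neighbours_def dest: simple_graph_edgeD)

text \<open>Fewer than \<open>k\<close> vertices cannot cut off \<open>D\<close>: a path that starts
  in \<open>D\<close> and avoids \<open>X\<close> never leaves \<open>D\<close>. A boundary that is
  too small is refuted by naming a vertex outside \<open>D\<close> and \<open>X\<close>.\<close>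

lemma k_connected_boundary:
  assumes con: "k_connected k V E"
    and D: "D \<subseteq> V" "D \<noteq> {}" and X: "X \<subseteq> V" "card X < k" and DX: "D \<inter> X = {}"
    and cl: "\<And>u w. u \<in> D \<Longrightarrow> {u, w} \<in> E \<Longrightarrow> w \<in> D \<union> X"
  shows "V \<subseteq> D \<union> X"
proof
  fix w assume w: "w \<in> V"
  show "w \<in> D \<union> X"
  proof (cases "w \<in> X")
    case False
    obtain u where u: "u \<in> D" using D by auto
    let ?R = "{(x, y). {x, y} \<in> {e \<in> E. e \<inter> X = {}}}"
    have "connected_graph (V - X) {e \<in> E. e \<inter> X = {}}"
      using con X by (auto simp: k_connected_def)
    then have "(u, w) \<in> ?R\<^sup>*"
      using u w False D(1) DX unfolding connected_graph_def by auto
    then have "w \<in> D"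
    proof (induction rule: rtrancl_induct)
      case base then show ?case by (rule u)
    next
      case (step y z) then show ?case using cl[of y z] by auto
    qed
    then show ?thesis by simp
  qed simp
qed

text \<open>Deleting \<open>xy\<close> keeps the number of vertices, so criticality yields a set
  \<open>T\<close> of fewer than \<open>k\<close> vertices that disconnects \<open>G - xy\<close>
  but not \<open>G\<close>. Thus \<open>xy\<close> is a bridge of \<open>G - T\<close>.\<close>

lemma minimally_k_connected_edge_separation:
  assumes G: "simple_graph V E" and min: "minimally_k_connected k V E" and e: "{x, y} \<in> E"
  obtains A S B where "edge_separation k V E x y A S B"
proof -
  have con: "k_connected k V E" and ncon: "\<not> k_connected k V (E - {{x, y}})"
    using min e by (auto simp: minimally_k_connected_def)
  obtain T where T: "T \<subseteq> V" "card T < k"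
    and nT: "\<not> connected_graph (V - T) {f \<in> E - {{x, y}}. f \<inter> T = {}}"
    using con ncon unfolding k_connected_def by blast
  have cT: "connected_graph (V - T) {f \<in> E. f \<inter> T = {}}"
    using con T by (auto simp: k_connected_def)
  let ?R = "{(x, y). {x, y} \<in> {f \<in> E. f \<inter> T = {}}}"
  let ?R' = "{(a, b). {a, b} \<in> {f \<in> E - {{x, y}}. f \<inter> T = {}}}"
  have symR': "sym (?R'\<^sup>*)"
    by (rule sym_rtrancl) (auto simp: sym_def insert_commute)
  \<comment> \<open>If \<open>T\<close> met the edge \<open>xy\<close>, then removing
    \<open>T\<close> would destroy that edge anyway, and \<open>G\<close> and \<open>G - xy\<close>
    would leave the same graph.\<close>
  have xyT: "x \<notin> T" "y \<notin> T"
  proof -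
    have "x \<notin> T \<and> y \<notin> T"
    proof (rule ccontr)
      assume "\<not> (x \<notin> T \<and> y \<notin> T)"
      then have "{f \<in> E - {{x, y}}. f \<inter> T = {}} = {f \<in> E. f \<inter> T = {}}" by auto
      with cT nT show False by simp
    qed
    then show "x \<notin> T" "y \<notin> T" by auto
  qed
  \<comment> \<open>Otherwise every use of \<open>xy\<close> in a path could be replaced by a
    detour, and \<open>G - xy - T\<close> would still be connected.\<close>
  have nxy: "(x, y) \<notin> ?R'\<^sup>*"
  proof
    assume xy: "(x, y) \<in> ?R'\<^sup>*"
    then have yx: "(y, x) \<in> ?R'\<^sup>*" using symR' by (meson symD)
    have "?R \<subseteq> ?R'\<^sup>*"
    proof clarify
      fix a b assume ab: "{a, b} \<in> E" "{a, b} \<inter> T = {}"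
      show "(a, b) \<in> ?R'\<^sup>*"
      proof (cases "{a, b} = {x, y}")
        case True
        then have "a = x \<and> b = y \<or> a = y \<and> b = x" by (simp add: doubleton_eq_iff)
        then show ?thesis using xy yx by auto
      next
        case False then show ?thesis using ab by (intro r_into_rtrancl) auto
      qed
    qed
    then have "?R\<^sup>* \<subseteq> ?R'\<^sup>*" by (rule rtrancl_subset_rtrancl)
    with cT have "connected_graph (V - T) {f \<in> E - {{x, y}}. f \<inter> T = {}}"
      unfolding connected_graph_def by blast
    with nT show False by blast
  qed
  \<comment> \<open>\<open>A\<close> is the component of \<open>x\<close> in
    \<open>G - xy - T\<close>; every other vertex outside \<open>T\<close> goes to
    \<open>B\<close>.\<close>
  define A where "A = {v \<in> V - T. (x, v) \<in> ?R'\<^sup>*}"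
  define B where "B = V - T - A"
  note xyV = simple_graph_edgeD[OF G e]
  have "edge_separation k V E x y A T B"
    unfolding edge_separation_def
  proof (intro conjI ballI impI)
    show "V = A \<union> T \<union> B" "A \<inter> T = {}" "A \<inter> B = {}" "T \<inter> B = {}"
      using T by (auto simp: A_def B_def)
    show "x \<in> A" using xyV xyT by (auto simp: A_def)
    show "y \<in> B" using xyV xyT nxy by (auto simp: A_def B_def)
    show "card T < k" by (rule T)
    fix a b assume a: "a \<in> A" and b: "b \<in> B" and ab: "{a, b} \<in> E"
    have "{a, b} = {x, y}"
    proof (rule ccontr)
      assume "{a, b} \<noteq> {x, y}"
      then have "(a, b) \<in> ?R'" using a b ab by (auto simp: A_def B_def)
      then have "(x, b) \<in> ?R'\<^sup>*" using a by (auto simp: A_def intro: rtrancl_into_rtrancl)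
      then show False using b by (auto simp: A_def B_def)
    qed
    then show "a = x" "b = y"
      using a b nxy by (auto simp: doubleton_eq_iff A_def B_def)
  qed
  then show ?thesis by (rule that)
qed

lemma card_Un3_disjoint:
  assumes "finite P" "finite Q" "finite R" "P \<inter> Q = {}" "P \<inter> R = {}" "Q \<inter> R = {}"
  shows "card (P \<union> Q \<union> R) = card P + card Q + card R"
proof -
  have "card (P \<union> Q \<union> R) = card (P \<union> Q) + card R"
    using assms by (intro card_Un_disjoint) auto
  then show ?thesis using assms by (simp add: card_Un_disjoint)
qed

text \<open>The corner \<open>B \<inter> A'\<close> contains \<open>y\<close>; if its boundary had fewer than \<open>k - 1\<close> vertices, then
  \<open>k\<close>-connectivity would reduce it to \<open>{y}\<close>, leaving at most \<open>k\<close> neighbours for \<open>y\<close>.\<close>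

lemma crossing_edge_separations:
  assumes G: "simple_graph V E" and con: "k_connected k V E"
    and s: "edge_separation k V E x y A S B" and s': "edge_separation k V E y z A' S' B'"
    and ne0: "x \<noteq> z" and xy: "{x, y} \<in> E" and yz: "{y, z} \<in> E"
    and deg: "k < card (neighbours E y)"
  shows "card B' < card B"
proof -
  have V: "V = A \<union> S \<union> B" "A \<inter> S = {}" "A \<inter> B = {}" "S \<inter> B = {}" "x \<in> A" "y \<in> B" "card S < k"
    and c: "\<And>a b. a \<in> A \<Longrightarrow> b \<in> B \<Longrightarrow> {a, b} \<in> E \<Longrightarrow> a = x \<and> b = y"
    using s by (auto simp: edge_separation_def)
  have V': "V = A' \<union> S' \<union> B'" "A' \<inter> S' = {}" "A' \<inter> B' = {}" "S' \<inter> B' = {}" "y \<in> A'" "z \<in> B'" "card S' < k"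
    and c': "\<And>a b. a \<in> A' \<Longrightarrow> b \<in> B' \<Longrightarrow> {a, b} \<in> E \<Longrightarrow> a = y \<and> b = z"
    using s' by (auto simp: edge_separation_def)
  have fin: "finite V" using G by (simp add: simple_graph_def)
  have fins: "finite A" "finite S" "finite B" "finite A'" "finite S'" "finite B'"
    using fin V(1) V'(1) by (metis finite_Un)+
  note EV = simple_graph_edgeD(2)[OF G]
  \<comment> \<open>\<open>X\<close> and \<open>Y\<close> bound the opposite corners
    \<open>B \<inter> A'\<close> and \<open>A \<inter> B'\<close>. Counting gives
    \<open>card X + card Y = card S + card S'\<close>.\<close>
  define X where "X = (S \<inter> A') \<union> (S \<inter> S') \<union> (B \<inter> S')"
  define Y where "Y = (S \<inter> B') \<union> (S \<inter> S') \<union> (A \<inter> S')"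
  have big: "k \<le> card X + 1"
  proof (rule ccontr)
    assume "\<not> k \<le> card X + 1"
    then have X2: "card X + 2 \<le> k" by simp
    let ?D = "B \<inter> A' - {y}"
    have Xfin: "finite X" "X \<subseteq> V" using fins V(1) unfolding X_def by auto
    show False
    proof (cases "?D = {}")
      case True
      \<comment> \<open>Since \<open>y\<close> lies in \<open>B\<close> and in \<open>A'\<close>,
        its only possible neighbour in \<open>A\<close> is \<open>x\<close> and its only possible
        neighbour in \<open>B'\<close> is \<open>z\<close>.\<close>
      have "neighbours E y \<subseteq> X \<union> {x, z}"
      proof
        fix w assume w: "w \<in> neighbours E y"
        then have yw: "{y, w} \<in> E" "{w, y} \<in> E" by (auto simp: neighbours_def insert_commute)
        have "w \<in> V" "w \<noteq> y" using simple_graph_edgeD[OF G yw(1)] by auto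
        moreover have "w = x" if "w \<in> A" using c[of w y] that V(6) yw by blast
        moreover have "w = z" if "w \<in> B'" using c'[of y w] that V'(5) yw by blast
        moreover have "w \<notin> B \<inter> A'" using True \<open>w \<noteq> y\<close> by auto
        ultimately show "w \<in> X \<union> {x, z}" using V(1) V'(1) unfolding X_def by blast
      qed
      then have "card (neighbours E y) \<le> card (X \<union> {x, z})"
        using Xfin by (intro card_mono) auto
      also have "\<dots> \<le> card X + card {x, z}" by (rule card_Un_le)
      also have "\<dots> \<le> k" using X2 by (simp add: card_insert_if split: if_splits)
      finally show False using deg by simp
    next
      case False
      \<comment> \<open>Edges may escape from the corner only through \<open>y\<close>, so
        \<open>y\<close> is moved into the boundary, which then still has fewer than
        \<open>k\<close> vertices. The vertex \<open>z\<close> lies outside both sets.\<close>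
      have "V \<subseteq> ?D \<union> (insert y X)"
      proof (rule k_connected_boundary[OF con _ False])
        show "?D \<subseteq> V" using V by auto
        show "insert y X \<subseteq> V" using V Xfin by auto
        show "card (insert y X) < k" using X2 Xfin by (simp add: card_insert_if)
        show "?D \<inter> insert y X = {}" using V(2-6) V'(2-6) by (auto simp: X_def)
        fix u w assume u: "u \<in> ?D" and uw: "{u, w} \<in> E"
        then have wu: "{w, u} \<in> E" by (simp add: insert_commute)
        have w: "w \<in> V" using EV uw by blast
        have "w \<notin> A" using c[of w u] u wu by auto
        moreover have "w \<notin> B'" using c'[of u w] u uw by auto
        ultimately show "w \<in> ?D \<union> insert y X" using w u V(1) V'(1) unfolding X_def by blast
      qed
      moreover have "z \<in> V" using V'(1,6) by blast
      moreover have "z \<notin> ?D \<union> insert y X" using V'(2-6) unfolding X_def by blast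
      ultimately show False by blast
    qed
  qed
  have cX: "card X = card (S \<inter> A') + card (S \<inter> S') + card (B \<inter> S')"
    unfolding X_def by (rule card_Un3_disjoint) (use fins V(2-4) V'(2-4) in blast)+
  have cY: "card Y = card (S \<inter> B') + card (S \<inter> S') + card (A \<inter> S')"
    unfolding Y_def by (rule card_Un3_disjoint) (use fins V(2-4) V'(2-4) in blast)+
  have split: "card T = card (T \<inter> P) + card (T \<inter> Q) + card (T \<inter> R)"
    if "finite V" "T \<subseteq> V" "V = P \<union> Q \<union> R" "P \<inter> Q = {}" "P \<inter> R = {}" "Q \<inter> R = {}" for T P Q R
  proof -
    have T: "T = T \<inter> P \<union> T \<inter> Q \<union> T \<inter> R" using that(2,3) by blast
    have "finite T" using that(1,2) by (rule rev_finite_subset)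
    then show ?thesis
      by (subst T, intro card_Un3_disjoint) (use that(4-6) in auto)
  qed
  have sub: "S \<subseteq> V" "B \<subseteq> V" "S' \<subseteq> V" "B' \<subseteq> V" using V(1) V'(1) by auto
  note cS = split[OF fin sub(1) V'(1-4)] and cB = split[OF fin sub(2) V'(1-4)]
    and cS' = split[OF fin sub(3) V(1-4)] and cB' = split[OF fin sub(4) V(1-4)]
  have cS'2: "card S' = card (A \<inter> S') + card (S \<inter> S') + card (B \<inter> S')"
    using cS' by (simp only: Int_commute[of S'])
  have cB'2: "card B' = card (A \<inter> B') + card (S \<inter> B') + card (B \<inter> B')"
    using cB' by (simp only: Int_commute[of B'])
  \<comment> \<open>From \<open>card X \<ge> k - 1\<close> and
    \<open>card X + card Y \<le> 2 * (k - 1)\<close> follows \<open>card Y < k\<close>, so a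
    nonempty corner \<open>A \<inter> B'\<close> would contradict connectivity, witnessed by
    \<open>y\<close>.\<close>
  have empty: "A \<inter> B' = {}"
  proof (rule ccontr)
    assume ne: "A \<inter> B' \<noteq> {}"
    have "V \<subseteq> (A \<inter> B') \<union> Y"
    proof (rule k_connected_boundary[OF con _ ne])
      show "A \<inter> B' \<subseteq> V" "Y \<subseteq> V" using V(1) V'(1) by (auto simp: Y_def)
      show "card Y < k"
        using big V(7) V'(7) cX cY cS cS'2
        by linarith
      show "A \<inter> B' \<inter> Y = {}" using V(2-6) V'(2-6) by (auto simp: Y_def)
      fix u w assume u: "u \<in> A \<inter> B'" and uw: "{u, w} \<in> E"
      then have wu: "{w, u} \<in> E" by (simp add: insert_commute)
      have w: "w \<in> V" using EV uw by blast
      have "{y, x} \<in> E" using xy by (simp add: insert_commute)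
      then have "x \<notin> B'" using c'[of y x] V'(5) ne0 by blast
      then have "w \<notin> B" using c[of u w] u uw by blast
      moreover have "w \<notin> A'"
      proof
        assume "w \<in> A'"
        then have "u = z" "w = y" using c'[of w u] u wu by auto
        then show False using c[of u w] u uw V(6) ne0 V'(6) \<open>x \<notin> B'\<close> by auto
      qed
      ultimately show "w \<in> A \<inter> B' \<union> Y" using w u V(1) V'(1) unfolding Y_def by blast
    qed
    moreover have "y \<in> V" "y \<notin> A \<inter> B' \<union> Y"
      using V(1-6) V'(2-6) unfolding Y_def by blast+
    ultimately show False by blast
  qed
  \<comment> \<open>Comparing \<open>S\<close> with \<open>X\<close> gives
    \<open>card (S \<inter> B') \<le> card (B \<inter> S')\<close>. With
    \<open>A \<inter> B'\<close> empty, \<open>B'\<close> is therefore no larger than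
    \<open>B\<close> without \<open>B \<inter> A'\<close>, and this part contains
    \<open>y\<close>.\<close>
  have "B \<inter> A' \<noteq> {}" using V(6) V'(5) by blast
  then have "0 < card (B \<inter> A')" using fins by (simp add: card_gt_0_iff)
  moreover have "card (A \<inter> B') = 0" using empty by simp
  ultimately show ?thesis
    using big V(7) cX cS cB cB'2 by linarith
qed

text \<open>Mader's theorem on the vertices of large degree, in a weak form: choose an oriented edge of
  the subgraph and a separation \<open>(A, S, B)\<close> of it with \<open>|B|\<close> minimal and move on to a next edge.\<close>

lemma minimally_k_connected_degenerate:
  assumes G: "simple_graph V E" and min: "minimally_k_connected k V E" and k: "1 \<le> k"
    and W: "W \<noteq> {}"
  shows "\<exists>v\<in>W. card {w \<in> W. {v, w} \<in> E} \<le> k"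
proof (rule ccontr)
  assume "\<not> ?thesis"
  then have deg: "k < card {w \<in> W. {v, w} \<in> E}" if "v \<in> W" for v
    using that by (simp add: not_le)
  have con: "k_connected k V E" using min by (simp add: minimally_k_connected_def)
  have fin: "finite V" using G by (simp add: simple_graph_def)
  \<comment> \<open>More than \<open>k \<ge> 1\<close> neighbours inside \<open>W\<close> allow a
    walk to go on without turning back.\<close>
  have step: "\<exists>w\<in>W. {v, w} \<in> E \<and> w \<noteq> u" if "v \<in> W" for u v
  proof (rule ccontr)
    assume "\<not> ?thesis"
    then have "{w \<in> W. {v, w} \<in> E} \<subseteq> {u}" by auto
    from card_mono[OF _ this] deg[OF that] k show False by simp
  qed
  define P where "P = (\<lambda>n. \<exists>x\<in>W. \<exists>y\<in>W. \<exists>A S B. {x, y} \<in> E \<and> edge_separation k V E x y A S B \<and> card B = n)"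
  have "\<exists>n. P n"
  proof -
    obtain x where "x \<in> W" using W by blast
    moreover obtain y where "y \<in> W" "{x, y} \<in> E" using step[OF \<open>x \<in> W\<close>] by blast
    moreover obtain A S B where "edge_separation k V E x y A S B"
      using minimally_k_connected_edge_separation[OF G min \<open>{x, y} \<in> E\<close>] .
    ultimately show ?thesis unfolding P_def by blast
  qed
  then have "P (LEAST n. P n)" by (auto intro: LeastI)
  then obtain x y A S B where xy: "x \<in> W" "y \<in> W" "{x, y} \<in> E"
    and s: "edge_separation k V E x y A S B" and B: "card B = (LEAST n. P n)"
    by (auto simp: P_def)
  obtain z where z: "z \<in> W" "{y, z} \<in> E" "z \<noteq> x" using step[OF xy(2)] by blast
  obtain A' S' B' where s': "edge_separation k V E y z A' S' B'"
    using minimally_k_connected_edge_separation[OF G min z(2)] .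
  have "neighbours E y \<subseteq> V" using neighbours_subset[OF G] by blast
  then have "card {w \<in> W. {y, w} \<in> E} \<le> card (neighbours E y)"
    using fin by (intro card_mono) (auto simp: neighbours_def intro: finite_subset)
  then have "k < card (neighbours E y)" using deg[OF xy(2)] by simp
  then have "card B' < card B"
    using crossing_edge_separations[OF G con s s' _ xy(3) z(2)] z(3) by simp
  moreover have "P (card B')" unfolding P_def using xy z s' by blast
  then have "card B \<le> card B'" unfolding B by (rule Least_le)
  ultimately show False by simp
qed

text \<open>In a separation of \<open>xy\<close>, a common neighbour of \<open>x\<close> and
  \<open>y\<close> on either side would give a second edge between \<open>A\<close> and
  \<open>B\<close>. All common neighbours thus lie in \<open>S\<close>.\<close>

lemma edge_separation_common_neighbours:
  assumes G: "simple_graph V E" and min: "minimally_k_connected k V E" and e: "{x, y} \<in> E"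
    and N: "\<And>w. w \<in> N \<Longrightarrow> {x, w} \<in> E \<and> {w, y} \<in> E"
  shows "card N < k"
proof -
  obtain A S B where s: "edge_separation k V E x y A S B"
    using minimally_k_connected_edge_separation[OF G min e] .
  have "N \<subseteq> S"
  proof
    fix w assume "w \<in> N"
    then have xw: "{x, w} \<in> E" and wy: "{w, y} \<in> E" using N by auto
    then have "w \<in> V" "w \<noteq> x" "w \<noteq> y"
      using simple_graph_edgeD[OF G xw] simple_graph_edgeD[OF G wy] by auto
    then show "w \<in> S" using s xw wy unfolding edge_separation_def by blast
  qed
  moreover have "finite S" using G s by (auto simp: simple_graph_def edge_separation_def)
  ultimately show ?thesis
    using card_mono[of S N] s by (auto simp: edge_separation_def)
qed

section \<open>Generic frameworks and affine independence\<close>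

definition eval_monomial :: "('i \<Rightarrow> real) \<Rightarrow> ('i \<Rightarrow>\<^sub>0 nat) \<Rightarrow> real" where
  "eval_monomial x m = (\<Prod>i\<in>Poly_Mapping.keys m. x i ^ Poly_Mapping.lookup m i)"

lemma eval_monomial_superset:
  assumes "finite K" "Poly_Mapping.keys m \<subseteq> K"
  shows "eval_monomial x m = (\<Prod>i\<in>K. x i ^ Poly_Mapping.lookup m i)"
  unfolding eval_monomial_def using assms
  by (intro prod.mono_neutral_left) (auto simp: in_keys_iff)

lemma eval_monomial_add: "eval_monomial x (a + b) = eval_monomial x a * eval_monomial x b"
proof -
  let ?K = "Poly_Mapping.keys a \<union> Poly_Mapping.keys b"
  show ?thesis
    using Poly_Mapping.keys_add[of a b]
    by (simp add: eval_monomial_superset[where K = ?K] lookup_add power_add prod.distrib)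
qed

lemma eval_mpoly_superset:
  assumes "finite K" "Poly_Mapping.keys f \<subseteq> K"
  shows "eval_mpoly x f = (\<Sum>m\<in>K. of_rat (Poly_Mapping.lookup f m) * eval_monomial x m)"
  unfolding eval_mpoly_def eval_monomial_def[symmetric] using assms
  by (intro sum.mono_neutral_left) (auto simp: in_keys_iff)

lemma eval_mpoly_zero [simp]: "eval_mpoly x 0 = 0"
  by (simp add: eval_mpoly_def)

lemma eval_mpoly_add: "eval_mpoly x (f + g) = eval_mpoly x f + eval_mpoly x g"
proof -
  let ?K = "Poly_Mapping.keys f \<union> Poly_Mapping.keys g"
  show ?thesis
    using Poly_Mapping.keys_add[of f g]
    by (simp add: eval_mpoly_superset[where K = ?K] lookup_add of_rat_add distrib_right sum.distrib)
qed

lemma eval_mpoly_single: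
  "eval_mpoly x (Poly_Mapping.single m c) = of_rat c * eval_monomial x m"
  by (simp add: eval_mpoly_def eval_monomial_def)

lemma eval_mpoly_sum: "eval_mpoly x (\<Sum>a\<in>A. f a) = (\<Sum>a\<in>A. eval_mpoly x (f a))"
  by (induction A rule: infinite_finite_induct) (auto simp: eval_mpoly_add)

lemma poly_mapping_update_eq_add:
  assumes "a \<notin> Poly_Mapping.keys f"
  shows "Poly_Mapping.update a b f = Poly_Mapping.single a b + f"
  using assms by (intro poly_mapping_eqI) (auto simp: lookup_update lookup_add lookup_single in_keys_iff)

lemma eval_mpoly_mult: "eval_mpoly x (f * g) = eval_mpoly x f * eval_mpoly x g"
proof -
  \<comment> \<open>First a single term times \<open>g\<close>, building \<open>g\<close> up term by
    term; the same induction on \<open>f\<close> then finishes.\<close>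
  have single: "eval_mpoly x (Poly_Mapping.single a b * g) =
      eval_mpoly x (Poly_Mapping.single a b) * eval_mpoly x g" for a b
    by (induction g rule: update_induct)
      (simp_all add: poly_mapping_update_eq_add distrib_left eval_mpoly_add mult_single
        eval_mpoly_single eval_monomial_add of_rat_mult)
  show ?thesis
    by (induction f rule: update_induct)
      (simp_all add: poly_mapping_update_eq_add distrib_right eval_mpoly_add single)
qed

text \<open>Semantic view of rational polynomials in the variables \<open>I\<close>: closure
  properties show that a determinant is one without writing down its coefficients.\<close>

definition poly_function :: "'i set \<Rightarrow> (('i \<Rightarrow> real) \<Rightarrow> real) \<Rightarrow> bool" where
  "poly_function I P \<longleftrightarrow> (\<exists>f. mpoly_vars f \<subseteq> I \<and> (\<forall>x. eval_mpoly x f = P x))"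

lemma poly_function_of_int: "poly_function I (\<lambda>x. of_int c)"
proof -
  have "eval_mpoly x (Poly_Mapping.single 0 (of_int c)) = of_int c" for x :: "'a \<Rightarrow> real"
    by (simp add: eval_mpoly_single eval_monomial_def del: single_of_int)
  then show ?thesis unfolding poly_function_def
    by (intro exI[of _ "Poly_Mapping.single 0 (of_int c)"]) (auto simp: mpoly_vars_def simp del: single_of_int)
qed

lemma poly_function_var:
  assumes "i \<in> I"
  shows "poly_function I (\<lambda>x. x i)"
proof -
  have "eval_mpoly x (Poly_Mapping.single (Poly_Mapping.single i 1) 1) = x i" for x :: "'a \<Rightarrow> real"
    by (simp add: eval_mpoly_single eval_monomial_def)
  then show ?thesis unfolding poly_function_def using assms
    by (intro exI[of _ "Poly_Mapping.single (Poly_Mapping.single i 1) 1"]) (auto simp: mpoly_vars_def)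
qed

lemma poly_function_add:
  assumes "poly_function I P" "poly_function I Q"
  shows "poly_function I (\<lambda>x. P x + Q x)"
proof -
  obtain f g where fg: "mpoly_vars f \<subseteq> I" "mpoly_vars g \<subseteq> I"
    and ev: "\<forall>x. eval_mpoly x f = P x" "\<forall>x. eval_mpoly x g = Q x"
    using assms unfolding poly_function_def by blast
  have "mpoly_vars (f + g) \<subseteq> I"
    using fg Poly_Mapping.keys_add[of f g] unfolding mpoly_vars_def by blast
  then show ?thesis unfolding poly_function_def
    using ev by (intro exI[of _ "f + g"]) (auto simp: eval_mpoly_add)
qed

lemma poly_function_mult:
  assumes "poly_function I P" "poly_function I Q"
  shows "poly_function I (\<lambda>x. P x * Q x)"
proof -
  obtain f g where fg: "mpoly_vars f \<subseteq> I" "mpoly_vars g \<subseteq> I"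
    and ev: "\<forall>x. eval_mpoly x f = P x" "\<forall>x. eval_mpoly x g = Q x"
    using assms unfolding poly_function_def by blast
  have "mpoly_vars (f * g) \<subseteq> I"
  proof
    fix i assume "i \<in> mpoly_vars (f * g)"
    then obtain a b where "a \<in> Poly_Mapping.keys f" "b \<in> Poly_Mapping.keys g"
      and "i \<in> Poly_Mapping.keys (a + b)"
      using Poly_Mapping.keys_mult[of f g] unfolding mpoly_vars_def by blast
    then show "i \<in> I" using fg Poly_Mapping.keys_add[of a b] unfolding mpoly_vars_def by blast
  qed
  then show ?thesis unfolding poly_function_def
    using ev by (intro exI[of _ "f * g"]) (auto simp: eval_mpoly_mult)
qed

lemma poly_function_sum:
  assumes "\<And>a. a \<in> A \<Longrightarrow> poly_function I (P a)"
  shows "poly_function I (\<lambda>x. \<Sum>a\<in>A. P a x)"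
  using assms
proof (induction A rule: infinite_finite_induct)
  case (insert a A) then show ?case by (simp add: poly_function_add)
qed (use poly_function_of_int[of I 0] in simp_all)

lemma poly_function_prod:
  assumes "\<And>a. a \<in> A \<Longrightarrow> poly_function I (P a)"
  shows "poly_function I (\<lambda>x. \<Prod>a\<in>A. P a x)"
  using assms
proof (induction A rule: infinite_finite_induct)
  case (insert a A) then show ?case by (simp add: poly_function_mult)
qed (use poly_function_of_int[of I 1] in simp_all)

text \<open>A nonzero value at one point \<open>y\<close> shows that the polynomial is nonzero.
  Generic nonvanishing is thereby reduced to exhibiting one good configuration.\<close>

lemma algebraically_independent_nonzero:
  assumes "algebraically_independent I x" "poly_function I P" "P y \<noteq> 0"
  shows "P x \<noteq> 0"
proof -
  obtain f where "mpoly_vars f \<subseteq> I" and f: "\<And>x. eval_mpoly x f = P x"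
    using assms(2) unfolding poly_function_def by blast
  moreover have "f \<noteq> 0" using assms(3) f[of y] by auto
  ultimately show ?thesis using assms(1) f unfolding algebraically_independent_def by metis
qed

lemma algebraically_independent_subset:
  "algebraically_independent I x \<Longrightarrow> J \<subseteq> I \<Longrightarrow> algebraically_independent J x"
  unfolding algebraically_independent_def by blast

section \<open>Existence of algebraically independent coordinates\<close>

lemma countable_poly_mapping:
  assumes "countable M"
  shows "countable {f :: 'k \<Rightarrow>\<^sub>0 'b :: {zero, countable}. Poly_Mapping.keys f \<subseteq> M}"
proof -
  let ?graph = "\<lambda>f :: 'k \<Rightarrow>\<^sub>0 'b. (\<lambda>k. (k, Poly_Mapping.lookup f k)) ` Poly_Mapping.keys f"
  \<comment> \<open>A finitely supported map is determined by its graph over its keys, which is a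
    finite subset of a countable set.\<close>
  have "inj_on ?graph {f. Poly_Mapping.keys f \<subseteq> M}"
  proof (rule inj_onI)
    fix f g assume eq: "?graph f = ?graph g"
    have keys: "Poly_Mapping.keys f = Poly_Mapping.keys g"
      using arg_cong[OF eq, of "image fst"] by (simp add: image_image)
    show "f = g"
    proof (rule poly_mapping_eqI)
      fix k
      show "Poly_Mapping.lookup f k = Poly_Mapping.lookup g k"
      proof (cases "k \<in> Poly_Mapping.keys f")
        case True
        then have "(k, Poly_Mapping.lookup f k) \<in> ?graph g" unfolding eq[symmetric] by simp
        then show ?thesis by auto
      next
        case False
        then show ?thesis using keys by (metis in_keys_iff)
      qed
    qed
  qed
  moreover have "countable {A. finite A \<and> A \<subseteq> M \<times> (UNIV :: 'b set)}"
    using assms by (intro countable_Collect_finite_subset) auto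
  then have "countable (?graph ` {f. Poly_Mapping.keys f \<subseteq> M})"
    by (rule countable_subset[rotated]) auto
  ultimately show ?thesis by (rule countable_image_inj_on[rotated])
qed

lemma countable_mpoly:
  assumes "finite I"
  shows "countable {f. mpoly_vars f \<subseteq> I}"
proof -
  have "countable {m :: 'a \<Rightarrow>\<^sub>0 nat. Poly_Mapping.keys m \<subseteq> I}"
    using assms by (intro countable_poly_mapping countable_finite)
  from countable_poly_mapping[OF this] show ?thesis
    by (rule countable_subset[rotated]) (auto simp: mpoly_vars_def)
qed

lemma eval_monomial_fun_upd:
  "eval_monomial (x(i := t)) m =
     t ^ Poly_Mapping.lookup m i * eval_monomial x (Poly_Mapping.update i 0 m)"
proof -
  let ?K = "insert i (Poly_Mapping.keys m)"
  have "eval_monomial (x(i := t)) m = (\<Prod>j\<in>?K. (x(i := t)) j ^ Poly_Mapping.lookup m j)"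
    by (rule eval_monomial_superset) auto
  also have "\<dots> = t ^ Poly_Mapping.lookup m i *
      (\<Prod>j\<in>Poly_Mapping.keys m - {i}. (x(i := t)) j ^ Poly_Mapping.lookup m j)"
    by (subst prod.insert_remove) auto
  also have "(\<Prod>j\<in>Poly_Mapping.keys m - {i}. (x(i := t)) j ^ Poly_Mapping.lookup m j) =
      eval_monomial x (Poly_Mapping.update i 0 m)"
    unfolding eval_monomial_def by (rule prod.cong) (auto simp: keys_update lookup_update)
  finally show ?thesis .
qed

text \<open>With the other coordinates fixed, \<open>f\<close> becomes a univariate real polynomial
  \<open>q\<close> in \<open>t\<close>. Its coefficients are rational polynomials evaluated at the
  independent point \<open>x\<close>, so \<open>q\<close> does not vanish identically.\<close>

lemma finite_roots_eval_mpoly: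
  assumes ind: "algebraically_independent I x" and f: "f \<noteq> 0" "mpoly_vars f \<subseteq> insert i I"
  shows "finite {t. eval_mpoly (x(i := t)) f = 0}"
proof -
  let ?c = "\<lambda>m. Poly_Mapping.lookup f m" and ?d = "\<lambda>m. Poly_Mapping.lookup m i"
    and ?u = "Poly_Mapping.update i (0::nat)"
  define q :: "real poly" where
    "q = (\<Sum>m\<in>Poly_Mapping.keys f. monom (of_rat (?c m) * eval_monomial x (?u m)) (?d m))"
  have q: "poly q t = eval_mpoly (x(i := t)) f" for t
    by (simp add: q_def poly_sum poly_monom eval_mpoly_superset[OF finite_keys order_refl]
        eval_monomial_fun_upd mult_ac)
  obtain m0 where m0: "m0 \<in> Poly_Mapping.keys f" using f(1) by (metis keys_eq_empty ex_in_conv)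
  let ?K = "{m \<in> Poly_Mapping.keys f. ?d m = ?d m0}"
  \<comment> \<open>\<open>g\<close> collects the terms whose degree in \<open>i\<close> is that of
    \<open>m0\<close>, with the variable \<open>i\<close> stripped off. Among these only
    \<open>m0\<close> is mapped to \<open>?u m0\<close>, so its coefficient cannot cancel.\<close>
  define g where "g = (\<Sum>m\<in>?K. Poly_Mapping.single (?u m) (?c m))"
  have u_inj: "m = m0" if "?d m = ?d m0" "?u m = ?u m0" for m
  proof (rule poly_mapping_eqI)
    fix j show "Poly_Mapping.lookup m j = Poly_Mapping.lookup m0 j"
      using that(1) arg_cong[OF that(2), of "\<lambda>p. Poly_Mapping.lookup p j"]
      by (auto simp: lookup_update split: if_splits)
  qed
  have "Poly_Mapping.lookup g (?u m0) = (\<Sum>m\<in>?K. if m = m0 then ?c m else 0)"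
    unfolding g_def lookup_sum
    by (rule sum.cong) (use u_inj in \<open>auto simp: lookup_single when_def\<close>)
  also have "\<dots> = ?c m0" using m0 by (subst sum.delta) auto
  finally have "g \<noteq> 0" using m0 by (auto simp: in_keys_iff)
  moreover have "mpoly_vars g \<subseteq> I"
  proof -
    have "Poly_Mapping.keys g \<subseteq> (\<Union>m\<in>?K. Poly_Mapping.keys (Poly_Mapping.single (?u m) (?c m)))"
      unfolding g_def by (rule Poly_Mapping.keys_sum)
    also have "\<dots> \<subseteq> ?u ` Poly_Mapping.keys f" by auto
    finally show ?thesis using f(2) by (fastforce simp: mpoly_vars_def keys_update)
  qed
  ultimately have "eval_mpoly x g \<noteq> 0" using ind by (auto simp: algebraically_independent_def)
  moreover have "coeff q (?d m0) = eval_mpoly x g"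
    by (simp add: q_def g_def coeff_sum eval_mpoly_sum eval_mpoly_single flip: sum.inter_filter)
  ultimately have "q \<noteq> 0" by auto
  then have "finite {t. poly q t = 0}" by (rule poly_roots_finite)
  then show ?thesis by (simp add: q)
qed

text \<open>Coordinates are added one at a time: each of countably many nonzero polynomials forbids
  finitely many values, and the reals are uncountable.\<close>

lemma ex_algebraically_independent:
  assumes "finite I"
  shows "\<exists>x. algebraically_independent I x"
  using assms
proof (induction I rule: finite_induct)
  case empty
  have "eval_mpoly x f \<noteq> 0" if "f \<noteq> 0" "mpoly_vars f \<subseteq> {}" for f :: "('a \<Rightarrow>\<^sub>0 nat) \<Rightarrow>\<^sub>0 rat" and x
  proof -
    have "Poly_Mapping.keys f \<subseteq> {0}" using that(2) by (auto simp: mpoly_vars_def)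
    then have "eval_mpoly x f = of_rat (Poly_Mapping.lookup f 0)"
      using eval_mpoly_superset[of "{0}" f x] by (simp add: eval_monomial_def)
    moreover have "0 \<in> Poly_Mapping.keys f"
      using that(1) \<open>Poly_Mapping.keys f \<subseteq> {0}\<close> by (metis keys_eq_empty subset_singletonD insertI1)
    ultimately show ?thesis by (auto simp: in_keys_iff)
  qed
  then show ?case by (auto simp: algebraically_independent_def)
next
  case (insert i I)
  then obtain x where x: "algebraically_independent I x" by blast
  let ?F = "{f. mpoly_vars f \<subseteq> insert i I \<and> f \<noteq> 0}"
  let ?bad = "\<Union>f\<in>?F. {t. eval_mpoly (x(i := t)) f = 0}"
  have "countable ?F"
    using insert by (intro countable_subset[OF _ countable_mpoly[of "insert i I"]]) auto
  then have "countable ?bad"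
    using finite_roots_eval_mpoly[OF x] by (intro countable_UN) (auto intro: countable_finite)
  then have "?bad \<noteq> UNIV" using uncountable_UNIV_real by metis
  then obtain t where "t \<notin> ?bad" by blast
  then have "algebraically_independent (insert i I) (x(i := t))"
    by (auto simp: algebraically_independent_def)
  then show ?case by blast
qed

lemma generic_some_generic_framework:
  assumes "finite V"
  shows "generic_framework m V (some_generic_framework m V)"
proof -
  obtain x where x: "algebraically_independent (V \<times> {..<m}) x"
    using ex_algebraically_independent[of "V \<times> {..<m}"] assms by auto
  have "generic_framework m V (\<lambda>v i. x (v, i))"
    using x by (simp add: generic_framework_def)
  then show ?thesis unfolding some_generic_framework_def by (rule someI[where P = "generic_framework m V"])
qed

lemma generic_framework_subset:
  "generic_framework m V p \<Longrightarrow> W \<subseteq> V \<Longrightarrow> generic_framework m W p"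
  unfolding generic_framework_def by (erule algebraically_independent_subset) auto

text \<open>Here the \<open>c\<close>-th column of the matrix is the \<open>c\<close>-th point with an entry \<open>1\<close> on top; placing
  the points at the origin and the unit vectors makes it upper unitriangular.\<close>

lemma generic_framework_affine_independent:
  assumes gen: "generic_framework m V p" and T: "finite T" "T \<subseteq> V" "card T \<le> m + 1"
    and sum0: "(\<Sum>x\<in>T. l x) = 0" and sump: "\<And>j. j < m \<Longrightarrow> (\<Sum>x\<in>T. l x * p x j) = 0"
    and x: "x \<in> T"
  shows "l x = 0"
proof -
  define n where "n = card T"
  obtain h where h: "bij_betw h {0..<n} T" using T(1) ex_bij_betw_nat_finite n_def by blast
  have hT: "h c \<in> T" if "c < n" for c using h that by (auto simp: bij_betw_def)
  define entry :: "('a \<times> nat \<Rightarrow> real) \<Rightarrow> nat \<Rightarrow> nat \<Rightarrow> real" where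
    "entry = (\<lambda>X r c. if r = 0 then 1 else X (h c, r - 1))"
  define M where "M = (\<lambda>X. mat n n (\<lambda>(r, c). entry X r c))"
  have M: "M X \<in> carrier_mat n n" for X by (simp add: M_def)
  let ?p = "\<lambda>(v, i). p v i"
  have sgn: "poly_function (V \<times> {..<m}) (\<lambda>X. signof \<pi>)" for \<pi> :: "nat \<Rightarrow> nat"
    by (rule poly_function_of_int)
  have ent: "poly_function (V \<times> {..<m}) (\<lambda>X. M X $$ (r, c))" if "r < n" "c < n" for r c
  proof (cases "r = 0")
    case True
    then show ?thesis using that poly_function_of_int[of _ 1] by (simp add: M_def entry_def)
  next
    case False
    have "(h c, r - 1) \<in> V \<times> {..<m}" using that False hT[of c] T by (auto simp: n_def)
    from poly_function_var[OF this] show ?thesis using that False by (simp add: M_def entry_def)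
  qed
  \<comment> \<open>By the Leibniz formula, the determinant is a rational polynomial in the
    coordinates.\<close>
  have "poly_function (V \<times> {..<m}) (\<lambda>X. det (M X))"
    unfolding det_def'[OF M]
    by (intro poly_function_sum poly_function_mult sgn poly_function_prod ent)
      (auto simp: permutes_in_image)
  moreover have "det (M (\<lambda>(v, i). if v = h (Suc i) \<and> Suc i < n then 1 else 0)) \<noteq> 0" (is "det ?A \<noteq> 0")
  proof -
    have inj: "h a = h b \<longleftrightarrow> a = b" if "a < n" "b < n" for a b
      using h that by (auto simp: bij_betw_def inj_on_def)
    have A: "?A $$ (r, c) = (if r = 0 \<or> r = c then 1 else 0)" if "r < n" "c < n" for r c
      using that inj by (auto simp: M_def entry_def)
    have "upper_triangular ?A" using A M by (auto intro!: upper_triangularI simp: M_def)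
    then have "det ?A = prod_list (diag_mat ?A)" by (rule det_upper_triangular[OF _ M])
    also have "diag_mat ?A = map (\<lambda>_. 1) [0..<n]"
      using A by (auto simp: diag_mat_def M_def)
    also have "prod_list \<dots> = (1::real)" by (simp add: map_replicate_const)
    finally show ?thesis by simp
  qed
  ultimately have det: "det (M ?p) \<noteq> 0"
    using algebraically_independent_nonzero gen unfolding generic_framework_def by blast
  \<comment> \<open>The dependence \<open>l\<close>, read as a vector, lies in the kernel of the
    matrix: row \<open>0\<close> is \<open>sum0\<close>, and row \<open>r > 0\<close> is
    \<open>sump\<close> for coordinate \<open>r - 1\<close>.\<close>
  define v where "v = vec n (\<lambda>c. l (h c))"
  have v: "v \<in> carrier_vec n" by (simp add: v_def)
  have "M ?p *\<^sub>v v = 0\<^sub>v n"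
  proof (rule eq_vecI)
    fix r assume "r < dim_vec (0\<^sub>v n :: real vec)"
    then have r: "r < n" by simp
    have "(M ?p *\<^sub>v v) $ r = (\<Sum>c\<in>{0..<n}. entry ?p r c * l (h c))"
      using r by (simp add: M_def v_def scalar_prod_def)
    also have "\<dots> = (\<Sum>c\<in>{0..<n}. (\<lambda>y. (if r = 0 then 1 else p y (r - 1)) * l y) (h c))"
      by (rule sum.cong) (auto simp: entry_def)
    also have "\<dots> = (\<Sum>y\<in>T. (if r = 0 then 1 else p y (r - 1)) * l y)"
      by (rule sum.reindex_bij_betw[OF h])
    also have "\<dots> = 0"
      using sum0 sump[of "r - 1"] r T(3) by (cases "r = 0") (auto simp: mult.commute n_def)
    finally show "(M ?p *\<^sub>v v) $ r = 0\<^sub>v n $ r" using r by simp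
  qed (simp add: M_def)
  then have "v = 0\<^sub>v n" using det det_0_iff_vec_prod_zero[OF M] v by blast
  moreover obtain c where "c < n" "h c = x" using h x by (auto simp: bij_betw_def)
  ultimately show ?thesis by (metis v_def index_vec index_zero_vec(1))
qed

section \<open>Independent rows of the rigidity matrix\<close>

text \<open>Gaussian elimination by induction on the equations: a pivot \<open>i0\<close> for
  equation \<open>j\<close> removes one unknown together with one equation.\<close>

lemma underdetermined_system_nontrivial:
  fixes A :: "'i \<Rightarrow> 'j \<Rightarrow> 'c :: field"
  assumes "finite J" "finite I" "card J < card I"
  shows "\<exists>c. (\<exists>i\<in>I. c i \<noteq> 0) \<and> (\<forall>j\<in>J. (\<Sum>i\<in>I. c i * A i j) = 0)"
  using assms
proof (induction J arbitrary: I A rule: finite_induct)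
  case empty
  then have "I \<noteq> {}" by auto
  then show ?case by (intro exI[of _ "\<lambda>_. 1"]) auto
next
  case (insert j J)
  show ?case
  proof (cases "\<forall>i\<in>I. A i j = 0")
    case True
    obtain c where "\<exists>i\<in>I. c i \<noteq> 0" "\<forall>j\<in>J. (\<Sum>i\<in>I. c i * A i j) = 0"
      using insert.IH[of I A] insert.prems insert.hyps by auto
    then show ?thesis using True by (intro exI[of _ c]) auto
  next
    case False
    then obtain i0 where i0: "i0 \<in> I" "A i0 j \<noteq> 0" by blast
    let ?I = "I - {i0}"
    have "card J < card ?I" using insert.prems insert.hyps i0 by simp
    then have "\<exists>c. (\<exists>i\<in>?I. c i \<noteq> 0) \<and>
        (\<forall>j'\<in>J. (\<Sum>i\<in>?I. c i * (A i j' - A i j / A i0 j * A i0 j')) = 0)"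
      using insert.prems(1) by (intro insert.IH) simp_all
    then obtain c where c: "\<exists>i\<in>?I. c i \<noteq> 0"
      "\<forall>j'\<in>J. (\<Sum>i\<in>?I. c i * (A i j' - A i j / A i0 j * A i0 j')) = 0"
      by blast
    \<comment> \<open>The pivot coefficient is chosen so that equation \<open>j\<close> holds;
      substituting it into the others gives the reduced system.\<close>
    let ?c = "c(i0 := - (\<Sum>i\<in>?I. c i * (A i j / A i0 j)))"
    have "(\<Sum>i\<in>I. ?c i * A i j') = (\<Sum>i\<in>?I. c i * (A i j' - A i j / A i0 j * A i0 j'))" for j'
    proof -
      have "(\<Sum>i\<in>I. ?c i * A i j') = ?c i0 * A i0 j' + (\<Sum>i\<in>?I. ?c i * A i j')"
        using insert.prems i0 by (intro sum.remove) auto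
      also have "(\<Sum>i\<in>?I. ?c i * A i j') = (\<Sum>i\<in>?I. c i * A i j')"
        by (rule sum.cong) auto
      finally show ?thesis
        by (simp add: right_diff_distrib sum_subtractf sum_distrib_right mult.assoc)
    qed
    then have "(\<Sum>i\<in>I. ?c i * A i j') = 0" if "j' \<in> insert j J" for j'
      using c(2) i0(2) that by auto
    moreover have "\<exists>i\<in>I. ?c i \<noteq> 0" using c(1) by auto
    ultimately show ?thesis by (intro exI[of _ ?c]) blast
  qed
qed

lemma rigidity_matrix_notin: "x \<notin> e \<Longrightarrow> rigidity_matrix p e (x, i) = 0"
  by (simp add: rigidity_matrix_def)

lemma rigidity_matrix_doubleton:
  assumes "x \<noteq> y"
  shows "rigidity_matrix p {x, y} (x, i) = p x i - p y i"
    and "rigidity_matrix p {x, y} (y, i) = p y i - p x i"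
proof -
  have "{x, y} - {x} = {y}" "{x, y} - {y} = {x}" using assms by auto
  then show "rigidity_matrix p {x, y} (x, i) = p x i - p y i"
    and "rigidity_matrix p {x, y} (y, i) = p y i - p x i"
    by (simp_all add: rigidity_matrix_def)
qed

lemma finite_all_pairs: "finite V \<Longrightarrow> finite (all_pairs V)"
  by (rule finite_subset[of _ "Pow V"]) (auto simp: all_pairs_def)

lemma card_all_pairs: "finite V \<Longrightarrow> card (all_pairs V) = card V choose 2"
  unfolding all_pairs_def by (rule n_subsets)

lemma all_pairsE:
  assumes "e \<in> all_pairs V"
  obtains x y where "e = {x, y}" "x \<noteq> y" "x \<in> V" "y \<in> V"
  using assms by (auto simp: all_pairs_def card_2_iff)

lemma inj_on_doubleton: "v \<notin> N \<Longrightarrow> inj_on (\<lambda>w. {v, w}) N"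
  by (auto simp: inj_on_def doubleton_eq_iff)

text \<open>Only the new rows are nonzero in the columns of \<open>v\<close>. A relation there is an
  affine dependence of at most \<open>m + 1\<close> generic points, so the new coefficients vanish
  and a relation on \<open>F\<close> remains.\<close>

lemma rows_independent_zero_extension:
  assumes gen: "generic_framework m V p" and fin: "finite V" and v: "v \<in> V"
    and F: "F \<subseteq> all_pairs (V - {v})" and ind: "rows_independent m (V - {v}) p F"
    and N: "N \<subseteq> V - {v}" "card N \<le> m"
  shows "rows_independent m V p (F \<union> (\<lambda>w. {v, w}) ` N)"
  unfolding rows_independent_def
proof (intro allI impI)
  let ?E = "F \<union> (\<lambda>w. {v, w}) ` N"
  fix c assume zero: "\<forall>j\<in>V \<times> {..<m}. (\<Sum>e\<in>?E. c e * rigidity_matrix p e j) = 0"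
  have finN: "finite N" using N fin by (meson finite_Diff finite_subset)
  have finF: "finite F" using F fin finite_all_pairs by (metis finite_Diff finite_subset)
  have vF: "v \<notin> e" if "e \<in> F" for e using F that by (auto simp: all_pairs_def)
  have vN: "v \<notin> N" using N by auto
  have split: "(\<Sum>e\<in>?E. c e * rigidity_matrix p e j) =
      (\<Sum>e\<in>F. c e * rigidity_matrix p e j) + (\<Sum>w\<in>N. c {v, w} * rigidity_matrix p {v, w} j)" for j
  proof -
    have "F \<inter> (\<lambda>w. {v, w}) ` N = {}" using vF by blast
    then show ?thesis
      using finF finN by (simp add: sum.union_disjoint sum.reindex[OF inj_on_doubleton[OF vN]])
  qed
  have col: "(\<Sum>w\<in>N. c {v, w} * (p v i - p w i)) = 0" if "i < m" for i
  proof -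
    have "(\<Sum>e\<in>F. c e * rigidity_matrix p e (v, i)) = 0"
      using vF by (intro sum.neutral) (auto simp: rigidity_matrix_notin)
    moreover have "(\<Sum>w\<in>N. c {v, w} * rigidity_matrix p {v, w} (v, i)) =
        (\<Sum>w\<in>N. c {v, w} * (p v i - p w i))"
    proof (rule sum.cong)
      fix w assume "w \<in> N"
      then have "v \<noteq> w" using vN by blast
      then show "c {v, w} * rigidity_matrix p {v, w} (v, i) = c {v, w} * (p v i - p w i)"
        by (simp add: rigidity_matrix_doubleton)
    qed simp
    ultimately show ?thesis using zero split[of "(v, i)"] that v by auto
  qed
  \<comment> \<open>The weight of \<open>v\<close> makes all weights sum to zero, which turns
    \<open>col\<close> into an affine dependence.\<close>
  define l where "l = (\<lambda>x. if x = v then - (\<Sum>w\<in>N. c {v, w}) else c {v, x})"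
  have sum_l: "(\<Sum>x\<in>insert v N. l x * f x) = (\<Sum>w\<in>N. c {v, w} * f w) - (\<Sum>w\<in>N. c {v, w}) * f v"
    for f :: "'a \<Rightarrow> real"
  proof -
    have "(\<Sum>x\<in>N. l x * f x) = (\<Sum>w\<in>N. c {v, w} * f w)"
      using vN by (intro sum.cong) (auto simp: l_def)
    then show ?thesis using vN finN by (simp add: l_def)
  qed
  have cN: "c {v, w} = 0" if "w \<in> N" for w
  proof -
    have "l w = 0"
    proof (rule generic_framework_affine_independent[OF gen, of "insert v N"])
      show "card (insert v N) \<le> m + 1" using finN vN N by simp
      show "(\<Sum>x\<in>insert v N. l x) = 0" using sum_l[of "\<lambda>_. 1"] by simp
      show "(\<Sum>x\<in>insert v N. l x * p x i) = 0" if "i < m" for i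
        using sum_l[of "\<lambda>x. p x i"] col[OF that]
        by (simp add: right_diff_distrib sum_subtractf sum_distrib_right)
    qed (use finN N v that in auto)
    moreover have "w \<noteq> v" using vN that by blast
    ultimately show ?thesis by (simp add: l_def)
  qed
  have "\<forall>j\<in>(V - {v}) \<times> {..<m}. (\<Sum>e\<in>F. c e * rigidity_matrix p e j) = 0"
    using zero split cN by auto
  then have "\<forall>e\<in>F. c e = 0" using ind by (auto simp: rows_independent_def)
  then show "\<forall>e\<in>?E. c e = 0" using cN by auto
qed

lemma simple_graph_delete_vertex:
  assumes "simple_graph V E"
  shows "simple_graph (V - {v}) {e \<in> E. v \<notin> e}"
    and "E = {e \<in> E. v \<notin> e} \<union> (\<lambda>w. {v, w}) ` neighbours E v"
    and "card E = card {e \<in> E. v \<notin> e} + card (neighbours E v)"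
proof -
  show "simple_graph (V - {v}) {e \<in> E. v \<notin> e}"
    using assms by (auto simp: simple_graph_def all_pairs_def)
  show E: "E = {e \<in> E. v \<notin> e} \<union> (\<lambda>w. {v, w}) ` neighbours E v"
  proof -
    have "e \<in> (\<lambda>w. {v, w}) ` neighbours E v" if "e \<in> E" "v \<in> e" for e
    proof -
      have "e \<in> all_pairs V" using assms that by (auto simp: simple_graph_def)
      then obtain x y where "e = {x, y}" by (rule all_pairsE)
      then show ?thesis using that by (auto simp: neighbours_def insert_commute)
    qed
    then show ?thesis by (auto simp: neighbours_def)
  qed
  have fin: "finite E" "finite V"
    using assms finite_all_pairs by (auto simp: simple_graph_def intro: finite_subset)
  have N: "neighbours E v \<subseteq> V - {v}" by (rule neighbours_subset[OF assms])
  then have "finite (neighbours E v)" using fin by (meson finite_Diff finite_subset)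
  moreover have "{e \<in> E. v \<notin> e} \<inter> (\<lambda>w. {v, w}) ` neighbours E v = {}" by auto
  moreover have "card ((\<lambda>w. {v, w}) ` neighbours E v) = card (neighbours E v)"
    using N by (intro card_image inj_on_doubleton) auto
  ultimately show "card E = card {e \<in> E. v \<notin> e} + card (neighbours E v)"
    using fin by (subst E, subst card_Un_disjoint) auto
qed

text \<open>Degeneracy passes to the graph without a vertex of degree at most \<open>m\<close>; that
  vertex is then attached again by a zero extension.\<close>

lemma degenerate_rows_independent:
  assumes "simple_graph V E" "generic_framework m V p"
    and "\<And>W. W \<subseteq> V \<Longrightarrow> W \<noteq> {} \<Longrightarrow> \<exists>v\<in>W. card {w \<in> W. {v, w} \<in> E} \<le> m"
  shows "rows_independent m V p E"
  using assms
proof (induction "card V" arbitrary: V E)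
  case 0
  then have "V = {}" by (simp add: simple_graph_def)
  then have "E = {}" using 0 by (auto simp: simple_graph_def all_pairs_def)
  then show ?case by (simp add: rows_independent_def)
next
  case (Suc n)
  note G = \<open>simple_graph V E\<close>
  have fin: "finite V" using G by (simp add: simple_graph_def)
  have "V \<noteq> {}" using Suc.hyps by auto
  then obtain v where v: "v \<in> V" "card {w \<in> V. {v, w} \<in> E} \<le> m" using Suc.prems(3)[of V] by auto
  have "neighbours E v = {w \<in> V. {v, w} \<in> E}" using neighbours_subset[OF G] by (auto simp: neighbours_def)
  then have N: "neighbours E v \<subseteq> V - {v}" "card (neighbours E v) \<le> m"
    using v neighbours_subset[OF G] by auto
  let ?E = "{e \<in> E. v \<notin> e}"
  have "rows_independent m (V - {v}) p ?E"
  proof (rule Suc.hyps(1))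
    show "n = card (V - {v})" using Suc.hyps fin v by simp
    show "simple_graph (V - {v}) ?E" by (rule simple_graph_delete_vertex[OF G])
    show "generic_framework m (V - {v}) p" using Suc.prems by (auto intro: generic_framework_subset)
    fix W assume W: "W \<subseteq> V - {v}" "W \<noteq> {}"
    then obtain u where u: "u \<in> W" "card {w \<in> W. {u, w} \<in> E} \<le> m" using Suc.prems(3)[of W] by auto
    have "finite W" using W fin by (meson finite_Diff finite_subset)
    then have "card {w \<in> W. {u, w} \<in> ?E} \<le> card {w \<in> W. {u, w} \<in> E}" by (intro card_mono) auto
    then show "\<exists>u\<in>W. card {w \<in> W. {u, w} \<in> ?E} \<le> m" using u by (intro bexI[of _ u]) auto
  qed
  from rows_independent_zero_extension[OF Suc.prems(2) fin v(1) _ this N]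
  have "rows_independent m V p (?E \<union> (\<lambda>w. {v, w}) ` neighbours E v)"
    using simple_graph_delete_vertex(1)[OF G] by (auto simp: simple_graph_def)
  then show ?case using simple_graph_delete_vertex(2)[OF G] by simp
qed

text \<open>The graph is \<open>m\<close>-degenerate: \<open>a\<close> misses both itself and
  \<open>b\<close>, and a proper vertex subset has at most \<open>m + 1\<close> elements, hence
  degrees at most \<open>m\<close>.\<close>

lemma rows_independent_incomplete:
  assumes G: "simple_graph V E" and gen: "generic_framework m V p" and card: "card V = m + 2"
    and ab: "a \<in> V" "b \<in> V" "a \<noteq> b" "{a, b} \<notin> E"
  shows "rows_independent m V p E"
proof (rule degenerate_rows_independent[OF G gen])
  fix W assume W: "W \<subseteq> V" "W \<noteq> {}"
  have fin: "finite V" using G by (simp add: simple_graph_def)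
  show "\<exists>v\<in>W. card {w \<in> W. {v, w} \<in> E} \<le> m"
  proof (cases "W = V")
    case True
    have "{w \<in> V. {a, w} \<in> E} \<subseteq> V - {a, b}"
      using neighbours_subset[OF G, of a] ab unfolding neighbours_def by blast
    then have "card {w \<in> V. {a, w} \<in> E} \<le> card (V - {a, b})" using fin by (intro card_mono) auto
    also have "\<dots> = m" using ab card fin by (simp add: card_Diff_subset)
    finally show ?thesis using True ab by auto
  next
    case False
    obtain v where v: "v \<in> W" using W by blast
    have finW: "finite W" using W fin by (meson finite_subset)
    have "card W < card V" using False W fin by (intro psubset_card_mono) auto
    moreover have "{w \<in> W. {v, w} \<in> E} \<subseteq> W - {v}"
      using neighbours_subset[OF G, of v] unfolding neighbours_def by blast
    then have "card {w \<in> W. {v, w} \<in> E} \<le> card (W - {v})" using finW by (intro card_mono) auto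
    ultimately show ?thesis using v card finW by (intro bexI[of _ v]) auto
  qed
qed

section \<open>Infinitesimal rigid motions and the dimension count\<close>

text \<open>The additional coordinate \<open>1\<close> at index \<open>m\<close> lets translations
  be treated as rotations involving that index.\<close>

definition homogeneous :: "nat \<Rightarrow> ('a \<Rightarrow> nat \<Rightarrow> real) \<Rightarrow> 'a \<Rightarrow> nat \<Rightarrow> real" where
  "homogeneous m p x i = (if i < m then p x i else 1)"

text \<open>\<open>D\<close> is an affine function vanishing on all points. For a square matrix,
  such a dependence of the coordinates yields a dependence of the \<open>m + 1\<close> points,
  contrary to affine independence.\<close>

lemma generic_framework_affinely_spanning:
  assumes gen: "generic_framework m V p" and fin: "finite V" and card: "m + 1 \<le> card V"
    and D: "\<And>x. x \<in> V \<Longrightarrow> (\<Sum>i\<le>m. D i * homogeneous m p x i) = 0" and i: "i \<le> m"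
  shows "D i = 0"
proof (rule ccontr)
  assume Di: "D i \<noteq> 0"
  obtain T where T: "T \<subseteq> V" "card T = m + 1" "finite T"
    using obtain_subset_with_card_n[OF card] by blast
  \<comment> \<open>Omitting coordinate \<open>i\<close> leaves \<open>m\<close> equations for
    \<open>m + 1\<close> weights; pairing with \<open>D\<close> then recovers the omitted equation,
    as \<open>D i \<noteq> 0\<close>.\<close>
  have "card ({..m} - {i}) < card T" using i T by simp
  from underdetermined_system_nontrivial[OF _ T(3) this, of "homogeneous m p"]
  obtain l where l: "\<exists>x\<in>T. l x \<noteq> 0"
    and l0: "\<And>j. j \<in> {..m} - {i} \<Longrightarrow> (\<Sum>x\<in>T. l x * homogeneous m p x j) = 0"
    by auto
  have "D i * (\<Sum>x\<in>T. l x * homogeneous m p x i) =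
      (\<Sum>j\<le>m. D j * (\<Sum>x\<in>T. l x * homogeneous m p x j))"
    using i l0 by (subst sum.remove[of _ i]) auto
  also have "\<dots> = (\<Sum>j\<le>m. \<Sum>x\<in>T. l x * (D j * homogeneous m p x j))"
    by (simp add: sum_distrib_left mult_ac)
  also have "\<dots> = (\<Sum>x\<in>T. l x * (\<Sum>j\<le>m. D j * homogeneous m p x j))"
    by (subst sum.swap) (simp add: sum_distrib_left)
  also have "\<dots> = 0" using D T(1) by (intro sum.neutral) auto
  finally have "(\<Sum>x\<in>T. l x * homogeneous m p x i) = 0" using Di by simp
  then have l0: "(\<Sum>x\<in>T. l x * homogeneous m p x j) = 0" if "j \<le> m" for j
    using l0[of j] that by (cases "j = i") auto
  have "l x = 0" if "x \<in> T" for x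
  proof (rule generic_framework_affine_independent[OF gen T(3,1) _ _ _ that])
    show "(\<Sum>x\<in>T. l x) = 0" using l0[of m] by (simp add: homogeneous_def)
    show "(\<Sum>x\<in>T. l x * p x j) = 0" if "j < m" for j using l0[of j] that by (simp add: homogeneous_def)
  qed (use T in simp)
  then show False using l by auto
qed

text \<open>Rotation in the coordinate plane \<open>a, b\<close> for \<open>a < b < m\<close>, and translation along the coordinate
  \<open>a\<close> for \<open>b = m\<close>.\<close>

definition rigid_motion :: "nat \<Rightarrow> ('a \<Rightarrow> nat \<Rightarrow> real) \<Rightarrow> nat \<times> nat \<Rightarrow> 'a \<times> nat \<Rightarrow> real" where
  "rigid_motion m p = (\<lambda>(b, a) (x, j).
     (if j = a then homogeneous m p x b else 0) - (if j = b then homogeneous m p x a else 0))"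

definition motion_indices :: "nat \<Rightarrow> (nat \<times> nat) set" where
  "motion_indices m = (SIGMA b:{..m}. {..<b})"

lemma finite_motion_indices [simp]: "finite (motion_indices m)"
  by (simp add: motion_indices_def)

lemma card_motion_indices: "card (motion_indices m) = (m + 1) choose 2"
proof -
  have "card (motion_indices m) = (\<Sum>b\<le>m. b)" by (simp add: motion_indices_def)
  also have "\<dots> = (m + 1) choose 2" by (induction m) (auto simp: choose_two)
  finally show ?thesis .
qed

text \<open>A rigid motion keeps edge lengths to first order: for a rotation the two products
  cancel, and for a translation both ends have the same velocity.\<close>

lemma rigid_motion_orthogonal:
  assumes fin: "finite V" and e: "e \<in> all_pairs V" and t: "t \<in> motion_indices m"
  shows "(\<Sum>j\<in>V \<times> {..<m}. rigidity_matrix p e j * rigid_motion m p t j) = 0"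
proof -
  obtain x y where xy: "e = {x, y}" "x \<noteq> y" "x \<in> V" "y \<in> V" using e by (rule all_pairsE)
  obtain b a where t: "t = (b, a)" "a < b" "b \<le> m" using t by (auto simp: motion_indices_def)
  let ?h = "homogeneous m p"
  have "(\<Sum>j\<in>V \<times> {..<m}. rigidity_matrix p e j * rigid_motion m p t j) =
      (\<Sum>u\<in>V. \<Sum>i<m. rigidity_matrix p e (u, i) * rigid_motion m p t (u, i))"
    by (simp add: sum.cartesian_product)
  also have "\<dots> = (\<Sum>u\<in>{x, y}. \<Sum>i<m. rigidity_matrix p e (u, i) * rigid_motion m p t (u, i))"
    using fin xy by (intro sum.mono_neutral_right) (auto simp: rigidity_matrix_notin)
  also have "\<dots> = (\<Sum>i<m. (p x i - p y i) * (rigid_motion m p t (x, i) - rigid_motion m p t (y, i)))"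
    using xy by (simp add: rigidity_matrix_doubleton sum.distrib[symmetric] algebra_simps)
  also have "\<dots> = (\<Sum>i<m. (if i = a then (p x i - p y i) * (?h x b - ?h y b) else 0)
      - (if i = b then (p x i - p y i) * (?h x a - ?h y a) else 0))"
    by (rule sum.cong) (auto simp: t rigid_motion_def algebra_simps)
  also have "\<dots> = (p x a - p y a) * (?h x b - ?h y b)
      - (if b < m then (p x b - p y b) * (?h x a - ?h y a) else 0)"
    using t by (simp add: sum_subtractf)
  also have "\<dots> = 0" using t by (auto simp: homogeneous_def)
  finally show ?thesis .
qed

lemma rigid_motions_independent:
  assumes gen: "generic_framework m V p" and fin: "finite V" and card: "m + 1 \<le> card V"
    and zero: "\<And>j. j \<in> V \<times> {..<m} \<Longrightarrow> (\<Sum>t\<in>motion_indices m. d t * rigid_motion m p t j) = 0"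
    and t: "t \<in> motion_indices m"
  shows "d t = 0"
proof -
  obtain b a where ba: "t = (b, a)" "a < b" "b \<le> m" using t by (auto simp: motion_indices_def)
  \<comment> \<open>Coordinate \<open>a\<close> of the combined velocity is an affine function of
    the position. \<open>D\<close> is its coefficient vector, a row of the skew-symmetric matrix
    formed from \<open>d\<close>.\<close>
  define D where "D = (\<lambda>i. if a < i then d (i, a) else if i < a then - d (a, i) else 0)"
  let ?h = "homogeneous m p"
  have "(\<Sum>i\<le>m. D i * ?h x i) = 0" if x: "x \<in> V" for x
  proof -
    have "(\<Sum>t\<in>motion_indices m. d t * rigid_motion m p t (x, a)) =
        (\<Sum>i\<le>m. \<Sum>j<i. d (i, j) * rigid_motion m p (i, j) (x, a))"
      unfolding motion_indices_def by (subst sum.Sigma) auto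
    also have "\<dots> = (\<Sum>i\<le>m. \<Sum>j<i. (if j = a then d (i, j) * ?h x i else 0)
        - (if i = a then d (i, j) * ?h x j else 0))"
      by (intro sum.cong) (auto simp: rigid_motion_def)
    also have "\<dots> = (\<Sum>i\<le>m. if a < i then d (i, a) * ?h x i else 0)
        - (\<Sum>i\<le>m. if i = a then (\<Sum>j<i. d (i, j) * ?h x j) else 0)"
    proof -
      have "(\<Sum>j<i. (if j = a then d (i, j) * ?h x i else 0) - (if i = a then d (i, j) * ?h x j else 0))
          = (if a < i then d (i, a) * ?h x i else 0)
            - (if i = a then (\<Sum>j<i. d (i, j) * ?h x j) else 0)" for i
        by (cases "i = a") (simp_all add: sum_subtractf sum_negf)
      then show ?thesis by (simp only: sum_subtractf)
    qed
    also have "\<dots> = (\<Sum>i\<le>m. if a < i then d (i, a) * ?h x i else 0) - (\<Sum>j<a. d (a, j) * ?h x j)"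
      using ba by simp
    also have "(\<Sum>j<a. d (a, j) * ?h x j) = (\<Sum>i\<le>m. if i < a then d (a, i) * ?h x i else 0)"
    proof -
      have "{..m} \<inter> {i. i < a} = {..<a}" using ba by auto
      then show ?thesis by (simp add: sum.If_cases)
    qed
    finally have "(\<Sum>t\<in>motion_indices m. d t * rigid_motion m p t (x, a)) =
        (\<Sum>i\<le>m. (if a < i then d (i, a) * ?h x i else 0) - (if i < a then d (a, i) * ?h x i else 0))"
      by (simp add: sum_subtractf)
    also have "\<dots> = (\<Sum>i\<le>m. D i * ?h x i)" by (rule sum.cong) (auto simp: D_def)
    finally show ?thesis using zero[of "(x, a)"] x ba by simp
  qed
  from generic_framework_affinely_spanning[OF gen fin card this ba(3)]
  show ?thesis using ba by (simp add: D_def)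
qed

text \<open>Independent rows and the independent rigid motions span orthogonal subspaces of a space
  of dimension \<open>m * card V\<close>, so their numbers add up to at most that dimension.\<close>

lemma rows_independent_card_le:
  assumes gen: "generic_framework m V p" and fin: "finite V" and card: "m + 1 \<le> card V"
    and F: "F \<subseteq> all_pairs V" and ind: "rows_independent m V p F"
  shows "card F + ((m + 1) choose 2) \<le> m * card V"
proof (rule ccontr)
  assume big: "\<not> ?thesis"
  let ?P = "motion_indices m" and ?J = "V \<times> {..<m}"
  have finF: "finite F" using F fin finite_all_pairs by (meson finite_subset)
  have "card ?J < card (F <+> ?P)"
    using big finF fin by (simp add: card_Plus card_motion_indices card_cartesian_product mult.commute)
  from underdetermined_system_nontrivial[OF _ _ this,
      of "case_sum (rigidity_matrix p) (rigid_motion m p)"]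
  obtain c where c: "\<exists>i\<in>F <+> ?P. c i \<noteq> 0"
    and zero: "\<And>j. j \<in> ?J \<Longrightarrow>
      (\<Sum>i\<in>F <+> ?P. c i * case_sum (rigidity_matrix p) (rigid_motion m p) i j) = 0"
    using fin finF by auto
  define q where "q = (\<lambda>j. \<Sum>t\<in>?P. c (Inr t) * rigid_motion m p t j)"
  define r where "r = (\<lambda>j. \<Sum>e\<in>F. c (Inl e) * rigidity_matrix p e j)"
  have rq: "r j + q j = 0" if "j \<in> ?J" for j
    using zero[OF that] finF by (simp add: sum.Plus r_def q_def)
  have "(\<Sum>j\<in>?J. r j * q j) = (\<Sum>j\<in>?J. \<Sum>e\<in>F. \<Sum>t\<in>?P.
      c (Inl e) * c (Inr t) * (rigidity_matrix p e j * rigid_motion m p t j))"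
    by (simp add: r_def q_def sum_product mult_ac)
  also have "\<dots> = (\<Sum>e\<in>F. \<Sum>t\<in>?P. \<Sum>j\<in>?J.
      c (Inl e) * c (Inr t) * (rigidity_matrix p e j * rigid_motion m p t j))"
    by (subst sum.swap, rule sum.cong[OF refl], rule sum.swap)
  also have "\<dots> = 0"
    using F by (simp add: sum_distrib_left[symmetric] rigid_motion_orthogonal[OF fin] subset_iff)
  \<comment> \<open>As \<open>r = - q\<close>, orthogonality makes the sum of the squares of
    \<open>q\<close> vanish. The relation thus splits into one among motions and one among
    rows.\<close>
  finally have "(\<Sum>j\<in>?J. r j * q j) = 0" .
  moreover have "(\<Sum>j\<in>?J. r j * q j) = (\<Sum>j\<in>?J. - (q j * q j))"
    using rq by (intro sum.cong) (auto simp: add_eq_0_iff2)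
  ultimately have "(\<Sum>j\<in>?J. q j * q j) = 0" by (simp add: sum_negf)
  then have q0: "q j = 0" if "j \<in> ?J" for j
    using that fin by (subst (asm) sum_nonneg_eq_0_iff) auto
  then have "c (Inr t) = 0" if "t \<in> ?P" for t
    using rigid_motions_independent[OF gen fin card _ that, of "\<lambda>t. c (Inr t)"] by (simp add: q_def)
  moreover have "\<forall>j\<in>?J. (\<Sum>e\<in>F. c (Inl e) * rigidity_matrix p e j) = 0"
    using rq q0 by (auto simp: r_def)
  then have "\<forall>e\<in>F. c (Inl e) = 0"
    using ind[unfolded rows_independent_def, THEN spec, of "\<lambda>e. c (Inl e)"] by (rule rev_mp)
  ultimately show False using c by auto
qed

section \<open>Subgraphs of minimally \<open>k\<close>-connected graphs\<close>

lemma minimally_k_connected_subgraph_degree: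
  assumes G: "simple_graph V E" and min: "minimally_k_connected k V E" and k: "1 \<le> k"
    and sub: "subgraph V' E' V E" and W: "W \<subseteq> V'" "W \<noteq> {}"
  shows "\<exists>v\<in>W. card {w \<in> W. {v, w} \<in> E'} \<le> k"
proof -
  obtain v where v: "v \<in> W" "card {w \<in> W. {v, w} \<in> E} \<le> k"
    using minimally_k_connected_degenerate[OF G min k W(2)] by blast
  have "finite W" using W sub by (auto simp: subgraph_def simple_graph_def intro: finite_subset)
  then have "card {w \<in> W. {v, w} \<in> E'} \<le> card {w \<in> W. {v, w} \<in> E}"
    using sub by (intro card_mono) (auto simp: subgraph_def)
  then show ?thesis using v by (intro bexI[of _ v]) auto
qed

text \<open>The additional \<open>1\<close> carries strictness through the induction. It is
  restricted to \<open>2 \<le> k\<close> because for \<open>k = 1\<close> the rank is zero and every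
  subtree attains equality.\<close>

lemma subgraph_large_independent_set:
  assumes G: "simple_graph V E" and min: "minimally_k_connected k V E" and k: "1 \<le> k"
    and "subgraph V' E' V E" "k + 1 \<le> card V'" "generic_framework (k - 1) V' p"
  shows "\<exists>F\<subseteq>E'. rows_independent (k - 1) V' p F \<and>
    card E' + k + (if 2 \<le> k \<and> \<not> is_complete_graph (k + 1) V' E' then 1 else 0) \<le> card F + card V'"
  using assms(4-)
proof (induction "card V'" arbitrary: V' E' rule: less_induct)
  case less
  have G': "simple_graph V' E'" using less.prems by (simp add: subgraph_def)
  have fin: "finite V'" "finite E'"
    using G' finite_all_pairs by (auto simp: simple_graph_def intro: finite_subset)
  show ?case
  proof (cases "card V' = k + 1")
    case n: True
    show ?thesis
    proof (cases "E' = all_pairs V'")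
      case True
      have "card E' > 0" using True n k fin by (simp add: card_all_pairs)
      then obtain e where e: "e \<in> E'" by (metis card_gt_0_iff ex_in_conv)
      then obtain a b where ab: "e = {a, b}" "a \<noteq> b" "a \<in> V'" "b \<in> V'" using True by (blast elim: all_pairsE)
      \<comment> \<open>Dropping one edge of the complete graph makes the remaining edges
        independent; the loss of one is exactly the margin \<open>card V' - k = 1\<close>.\<close>
      have "rows_independent (k - 1) V' p (E' - {e})"
        using G' less.prems(3) n k ab
        by (intro rows_independent_incomplete[of _ _ _ _ a b]) (auto simp: simple_graph_def)
      moreover have "card (E' - {e}) + 1 = card E'" using card.remove[OF fin(2) e] by simp
      ultimately show ?thesis
        using True n fin by (intro exI[of _ "E' - {e}"]) (auto simp: is_complete_graph_def)
    next
      case False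
      then obtain e where "e \<in> all_pairs V'" "e \<notin> E'" using G' unfolding simple_graph_def by blast
      then obtain a b where "a \<in> V'" "b \<in> V'" "a \<noteq> b" "{a, b} \<notin> E'" by (metis all_pairsE)
      \<comment> \<open>Here all edges count, and the margin \<open>card V' - k = 1\<close> supplies
        the strictness.\<close>
      then have "rows_independent (k - 1) V' p E'"
        using G' less.prems(3) n k by (intro rows_independent_incomplete[of _ _ _ _ a b]) auto
      then show ?thesis using n by (intro exI[of _ E']) auto
    qed
  next
    case n: False
    then have n: "k + 2 \<le> card V'" using less.prems(2) by simp
    have "V' \<noteq> {}" using n by auto
    then obtain v where v: "v \<in> V'" "card {w \<in> V'. {v, w} \<in> E'} \<le> k"
      using minimally_k_connected_subgraph_degree[OF G min k less.prems(1) order_refl] by blast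
    let ?N = "neighbours E' v" and ?V = "V' - {v}" and ?E = "{e \<in> E'. v \<notin> e}"
    have N: "?N \<subseteq> ?V" by (rule neighbours_subset[OF G'])
    then have "?N = {w \<in> V'. {v, w} \<in> E'}" by (auto simp: neighbours_def)
    then have degk: "card ?N \<le> k" using v by simp
    have finN: "finite ?N" using N fin by (meson finite_Diff finite_subset)
    have cV: "card V' = card ?V + 1" using card.remove[OF fin(1) v(1)] by simp
    note del = simple_graph_delete_vertex[OF G', of v]
    have sub: "subgraph ?V ?E V E" using del less.prems(1) by (auto simp: subgraph_def)
    have "\<exists>F\<subseteq>?E. rows_independent (k - 1) ?V p F \<and>
      card ?E + k + (if 2 \<le> k \<and> \<not> is_complete_graph (k + 1) ?V ?E then 1 else 0) \<le> card F + card ?V"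
    proof (rule less.hyps[OF _ sub])
      show "card ?V < card V'" "k + 1 \<le> card ?V" using cV n by simp_all
      show "generic_framework (k - 1) ?V p"
        using less.prems(3) by (rule generic_framework_subset) blast
    qed
    then obtain F where F: "F \<subseteq> ?E" "rows_independent (k - 1) ?V p F" and cF:
      "card ?E + k + (if 2 \<le> k \<and> \<not> is_complete_graph (k + 1) ?V ?E then 1 else 0) \<le> card F + card ?V"
      by blast
    \<comment> \<open>A zero extension in dimension \<open>k - 1\<close> admits at most
      \<open>k - 1\<close> new edges. At degree \<open>k\<close> one edge is lost, which the new
      vertex in \<open>card V'\<close> makes up for; at a smaller degree there is a gain of
      one.\<close>
    obtain M where M: "M \<subseteq> ?N" "card M = min (k - 1) (card ?N)"
      using obtain_subset_with_card_n[OF min.cobounded2] by metis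
    have finM: "finite M" using M finN by (meson finite_subset)
    let ?F = "F \<union> (\<lambda>w. {v, w}) ` M"
    have ind: "rows_independent (k - 1) V' p ?F"
      using del(1) F M N
      by (intro rows_independent_zero_extension[OF less.prems(3) fin(1) v(1)]) (auto simp: simple_graph_def)
    have sub': "?F \<subseteq> E'" using F M by (auto simp: neighbours_def)
    have "card ?F = card F + card M"
    proof -
      have "card ((\<lambda>w. {v, w}) ` M) = card M"
        using M N by (intro card_image inj_on_doubleton) auto
      moreover have "F \<inter> (\<lambda>w. {v, w}) ` M = {}" using F by auto
      moreover have "finite F" using F fin by (auto intro: finite_subset)
      ultimately show ?thesis using finM by (simp add: card_Un_disjoint)
    qed
    \<comment> \<open>Two neighbours \<open>x\<close>, \<open>y\<close> of \<open>v\<close> would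
      have as common neighbours \<open>v\<close> and the other \<open>k - 1\<close> vertices of the
      complete graph, so \<open>xy\<close> could not be critical.\<close>
    moreover have "\<not> is_complete_graph (k + 1) ?V ?E" if k2: "2 \<le> k" and Nk: "card ?N = k"
    proof
      assume comp: "is_complete_graph (k + 1) ?V ?E"
      obtain x y where xy: "x \<in> ?N" "y \<in> ?N" "x \<noteq> y"
      proof -
        obtain S where "S \<subseteq> ?N" "card S = 2" using obtain_subset_with_card_n[of 2 ?N] k2 Nk by metis
        then show ?thesis using that unfolding card_2_iff by blast
      qed
      have E: "{a, b} \<in> E" if "a \<in> ?V" "b \<in> ?V" "a \<noteq> b" for a b
      proof -
        have "{a, b} \<in> all_pairs ?V" using that by (auto simp: all_pairs_def)
        then show ?thesis using comp sub by (auto simp: is_complete_graph_def subgraph_def)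
      qed
      have vE: "{v, w} \<in> E" "{w, v} \<in> E" if "w \<in> ?N" for w
        using that less.prems(1) by (auto simp: neighbours_def subgraph_def insert_commute)
      have "card (V' - {x, y}) < k"
      proof (rule edge_separation_common_neighbours[OF G min, of x y])
        show "{x, y} \<in> E" using xy N by (intro E) auto
        fix w assume w: "w \<in> V' - {x, y}"
        show "{x, w} \<in> E \<and> {w, y} \<in> E"
        proof (cases "w = v")
          case True then show ?thesis using vE xy by auto
        next
          case False then show ?thesis using E[of x w] E[of w y] w xy N by auto
        qed
      qed
      moreover have "card (V' - {x, y}) = card V' - 2"
        using xy N fin by (subst card_Diff_subset) auto
      ultimately show False using n by simp
    qed
    ultimately have "card E' + k + (if 2 \<le> k \<and> \<not> is_complete_graph (k + 1) V' E' then 1 else 0)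
        \<le> card ?F + card V'"
      using cF M(2) degk cV del(3) k
      by (cases "card ?N = k") (auto split: if_splits)
    with ind sub' show ?thesis by blast
  qed
qed

section \<open>Rank bounds and conclusion\<close>

lemma card_le_rigidity_rank:
  assumes "finite E" "F \<subseteq> E" "rows_independent m V (some_generic_framework m V) F"
  shows "card F \<le> rigidity_rank m V E"
  unfolding rigidity_rank_def rigidity_indep_sets_def using assms by (intro Max_ge) auto

lemma rigidity_rank_le:
  assumes "finite E"
    and "\<And>F. F \<subseteq> E \<Longrightarrow> rows_independent m V (some_generic_framework m V) F \<Longrightarrow> card F \<le> n"
  shows "rigidity_rank m V E \<le> n"
proof -
  have "{} \<in> rigidity_indep_sets m V E"
    by (simp add: rigidity_indep_sets_def rows_independent_def)
  moreover have "finite (rigidity_indep_sets m V E)"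
    using assms(1) by (auto simp: rigidity_indep_sets_def)
  ultimately show ?thesis
    unfolding rigidity_rank_def using assms(2)
    by (subst Max_le_iff) (auto simp: rigidity_indep_sets_def)
qed

text \<open>Integers avoid truncated subtraction. The converse of the equality case is stated for
  \<open>k \<ge> 2\<close>: for \<open>k = 1\<close> the graph is a tree, and all its subtrees with
  at least two vertices attain equality.\<close>

theorem theorem6p4:
  fixes k :: nat and V :: "'a set" and E :: "'a set set"
  assumes "k \<ge> 1"
    and "simple_graph V E"
    and "minimally_k_connected k V E"
  shows "rigidity_independent k V E \<and>
    (\<forall>V' E'. subgraph V' E' V E \<and> card V' \<ge> k + 1 \<longrightarrow>
       int (card E') \<le> int (rigidity_rank (k - 1) V' E') + int (card V') - int k \<and>
       int (rigidity_rank (k - 1) V' E') + int (card V') - int k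
         \<le> int k * int (card V') - int ((k + 1) choose 2) \<and>
       (is_complete_graph (k + 1) V' E' \<longrightarrow>
          int (card E') = int (rigidity_rank (k - 1) V' E') + int (card V') - int k) \<and>
       (k \<ge> 2 \<longrightarrow>
          (int (card E') = int (rigidity_rank (k - 1) V' E') + int (card V') - int k
             \<longleftrightarrow> is_complete_graph (k + 1) V' E')))"
proof (intro conjI allI impI)
  have "finite V" using assms(2) by (simp add: simple_graph_def)
  then have "generic_framework k V (some_generic_framework k V)" by (rule generic_some_generic_framework)
  moreover have "subgraph V E V E" using assms(2) by (simp add: subgraph_def)
  ultimately have "rows_independent k V (some_generic_framework k V) E"
    using minimally_k_connected_subgraph_degree[OF assms(2,3,1)]
    by (intro degenerate_rows_independent[OF assms(2)])
  then show "rigidity_independent k V E" by (simp add: rigidity_independent_def rigidity_indep_sets_def)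
next
  fix V' E' assume "subgraph V' E' V E \<and> card V' \<ge> k + 1"
  then have sub: "subgraph V' E' V E" and n: "k + 1 \<le> card V'" by auto
  let ?r = "rigidity_rank (k - 1) V' E'" and ?n = "card V'"
  have fin: "finite V'" and E': "E' \<subseteq> all_pairs V'"
    using sub by (auto simp: subgraph_def simple_graph_def)
  have finE: "finite E'" using E' finite_all_pairs[OF fin] by (rule finite_subset)
  have gen: "generic_framework (k - 1) V' (some_generic_framework (k - 1) V')"
    by (rule generic_some_generic_framework[OF fin])
  have lower: "card E' + k + (if 2 \<le> k \<and> \<not> is_complete_graph (k + 1) V' E' then 1 else 0) \<le> ?r + ?n"
  proof -
    obtain F where "F \<subseteq> E'" "rows_independent (k - 1) V' (some_generic_framework (k - 1) V') F"
      and "card E' + k + (if 2 \<le> k \<and> \<not> is_complete_graph (k + 1) V' E' then 1 else 0) \<le> card F + ?n"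
      using subgraph_large_independent_set[OF assms(2,3,1) sub n gen] by blast
    moreover from this have "card F \<le> ?r" by (intro card_le_rigidity_rank[OF finE])
    ultimately show ?thesis by linarith
  qed
  show le: "int (card E') \<le> int ?r + int ?n - int k" using lower by (simp split: if_splits)
  have "?r \<le> (k - 1) * ?n - (k choose 2)"
  proof (rule rigidity_rank_le[OF finE])
    fix F assume "F \<subseteq> E'" "rows_independent (k - 1) V' (some_generic_framework (k - 1) V') F"
    then have "card F + ((k - 1 + 1) choose 2) \<le> (k - 1) * ?n"
      using E' n by (intro rows_independent_card_le[OF gen fin]) auto
    then show "card F \<le> (k - 1) * ?n - (k choose 2)" using assms(1) by simp
  qed
  \<comment> \<open>The dimension count for the empty set shows that the natural-number subtraction
    above is not truncated.\<close>
  moreover have "(k choose 2) \<le> (k - 1) * ?n"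
    using rows_independent_card_le[OF gen fin, of "{}"] n assms(1) by (simp add: rows_independent_def)
  ultimately have "?r + (k choose 2) \<le> (k - 1) * ?n" by linarith
  then have "int (?r + (k choose 2)) \<le> int ((k - 1) * ?n)" by (simp only: of_nat_le_iff)
  then have upper: "int ?r + int (k choose 2) \<le> (int k - 1) * int ?n"
    using assms(1) by (simp add: of_nat_diff)
  have choose: "(k + 1) choose 2 = (k choose 2) + k"
    by (simp add: numeral_2_eq_2)
  show "int ?r + int ?n - int k \<le> int k * int ?n - int ((k + 1) choose 2)"
    unfolding choose using upper by (simp add: algebra_simps)
  show eq: "int (card E') = int ?r + int ?n - int k" if comp: "is_complete_graph (k + 1) V' E'"
  \<comment> \<open>For \<open>?n = k + 1\<close> the upper bound
    \<open>k * ?n - ((k + 1) choose 2)\<close> equals the number of edges of the complete graph, so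
    both inequalities are tight.\<close>
  proof -
    have n: "?n = k + 1" and "card E' = (k + 1) choose 2"
      using comp fin by (auto simp: is_complete_graph_def card_all_pairs)
    moreover have "2 * int (k choose 2) = int k * (int k - 1)"
    proof -
      have "even (k * (k - 1))" by (cases "even k") auto
      then have "2 * (k choose 2) = k * (k - 1)" unfolding choose_two by (rule dvd_mult_div_cancel)
      then have "int (2 * (k choose 2)) = int (k * (k - 1))" by (simp only:)
      then show ?thesis using assms(1) by (simp add: of_nat_diff)
    qed
    ultimately have "int ?r + int ?n - int k \<le> int (card E')"
      using upper unfolding choose by (simp add: algebra_simps)
    then show ?thesis using le by simp
  qed
  show "int (card E') = int ?r + int ?n - int k \<longleftrightarrow> is_complete_graph (k + 1) V' E'" if "2 \<le> k"
    using lower eq that by (auto split: if_splits)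
qed

end
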